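(* Let $S=k[x_1,\ldots,x_n]$ be a polynomial ring over a field $k$. Let $u=x_t^{a_t}\cdots x_n^{a_n}$, $v=x_t^{b_t}\cdots x_n^{b_n}$ be two monomials of degree $d$, $u>_{lex}v$, $a_t\neq 0$, $t\geq 1$, and let $I=(\mathcal L(u,v))$ be a lexsegment ideal which is not a completely lexsegment ideal. Then $I$ is a Gotzmann ideal in $S$ if and only if $I=m(x_l,x_{l+1},\ldots,x_{l+p})$ for some $t\leq l\leq n$, some $1\leq p\leq n-l$ and a monomial $m$.
   Context: Monomials are ordered by the lexicographic order with $x_1>\cdots>x_n$; $\mathrm{Mon}_d(S)$ is the set of monomials of degree $d$ of $S$. For $u\geq_{lex}v$ in $\mathrm{Mon}_d(S)$, $\mathcal L(u,v)=\{w\in\mathrm{Mon}_d(S): u\geq_{lex}w\geq_{lex}v\}$ is the lexsegment set determined by $u,v$ and $(\mathcal L(u,v))$ is a lexsegment ideal. The shadow of a set $L$ of monomials is $\{x_1,\ldots,x_n\}L$. A lexsegment set is a completely lexsegment set if all its iterated shadows are lexsegment sets; the ideal it generates is then a completely lexsegment ideal. For a graded ideal $I$, $I^{lex}$ denotes the unique lexicographic ideal with the same Hilbert function as $I$ (each component $(I^{lex})_j$ is spanned by the initial lexsegment, i.e. the lexicographically largest monomials, of degree $j$ of cardinality $\dim_kI_j$). A graded ideal $I$ generated in degree $d$ is Gotzmann if the number of generators of $(x_1,\ldots,x_n)I$ is the smallest possible, i.e. equals the number of generators of $(x_1,\ldots,x_n)(I^{lex})_{\langle d\rangle}$, where $(I^{lex})_{\langle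 d\rangle}$ is the ideal generated by $(I^{lex})_d$; equivalently, $I$ and $(I^{lex})_{\langle d\rangle}$ have the same Hilbert function. *)

theory Defs
  imports Complex_Main "HOL-Library.Poly_Mapping" "HOL-Algebra.Ideal_Product"
begin

section \<open>Monomials and the lexicographic order\<close>

text \<open>
  A monomial is its exponent vector, of type \<^typ>\<open>nat \<Rightarrow>\<^sub>0 nat\<close>; a monomial of
  \<open>k[x\<^sub>1,\<dots>,x\<^sub>n]\<close> has support in \<open>{1..n}\<close>. Multiplication of monomials is addition of
  exponent vectors. The order on \<^typ>\<open>nat \<Rightarrow>\<^sub>0 nat\<close> provided by the library compares two
  exponent vectors at the least index where they differ, so on monomials it is the
  lexicographic order with \<open>x\<^sub>1 > x\<^sub>2 > \<dots> > x\<^sub>n\<close>, and \<^term>\<open>(<)\<close>, \<^term>\<open>(\<le>)\<close> are used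
  directly.
\<close>

definition mon_degree :: "(nat \<Rightarrow>\<^sub>0 nat) \<Rightarrow> nat" where
  "mon_degree w = (\<Sum>i\<in>Poly_Mapping.keys w. Poly_Mapping.lookup w i)"

definition Mon :: "nat \<Rightarrow> nat \<Rightarrow> (nat \<Rightarrow>\<^sub>0 nat) set" where
  "Mon n d = {w. Poly_Mapping.keys w \<subseteq> {1..n} \<and> mon_degree w = d}"

definition lexseg :: "nat \<Rightarrow> nat \<Rightarrow> (nat \<Rightarrow>\<^sub>0 nat) \<Rightarrow> (nat \<Rightarrow>\<^sub>0 nat) \<Rightarrow> (nat \<Rightarrow>\<^sub>0 nat) set" where
  "lexseg n d u v = {w \<in> Mon n d. v \<le> w \<and> w \<le> u}"

definition lexsegment_set :: "nat \<Rightarrow> nat \<Rightarrow> (nat \<Rightarrow>\<^sub>0 nat) set \<Rightarrow> bool" where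
  "lexsegment_set n d L \<longleftrightarrow> (\<exists>u\<in>Mon n d. \<exists>v\<in>Mon n d. v \<le> u \<and> L = lexseg n d u v)"

definition shadow :: "nat \<Rightarrow> (nat \<Rightarrow>\<^sub>0 nat) set \<Rightarrow> (nat \<Rightarrow>\<^sub>0 nat) set" where
  "shadow n L = {Poly_Mapping.single i 1 + w | i w. i \<in> {1..n} \<and> w \<in> L}"

definition completely_lexsegment_set :: "nat \<Rightarrow> nat \<Rightarrow> (nat \<Rightarrow>\<^sub>0 nat) set \<Rightarrow> bool" where
  "completely_lexsegment_set n d L \<longleftrightarrow>
     lexsegment_set n d L \<and> (\<forall>i. lexsegment_set n (d + i) ((shadow n ^^ i) L))"

text \<open>The \<open>r\<close> lexicographically largest monomials of degree \<open>j\<close>.\<close>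

definition initial_lexseg :: "nat \<Rightarrow> nat \<Rightarrow> nat \<Rightarrow> (nat \<Rightarrow>\<^sub>0 nat) set" where
  "initial_lexseg n j r = {w \<in> Mon n j. card {w' \<in> Mon n j. w < w'} < r}"


section \<open>The polynomial ring and its ideals\<close>

type_synonym 'k mpoly = "(nat \<Rightarrow>\<^sub>0 nat) \<Rightarrow>\<^sub>0 'k"

text \<open>
  \<open>k[x\<^sub>1,\<dots>,x\<^sub>n]\<close> is a subring of the ring \<^typ>\<open>'k mpoly\<close> of polynomials in countably many
  variables, whose multiplication is the convolution product of finitely supported functions.
\<close>

definition poly_ring :: "nat \<Rightarrow> 'k::field mpoly ring" where
  "poly_ring n = \<lparr>carrier = {p. \<forall>w\<in>Poly_Mapping.keys p. Poly_Mapping.keys w \<subseteq> {1..n}},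
                  mult = (*), one = 1, zero = 0, add = (+)\<rparr>"

definition mon_poly :: "(nat \<Rightarrow>\<^sub>0 nat) \<Rightarrow> 'k::field mpoly" where
  "mon_poly w = Poly_Mapping.single w 1"

definition var :: "nat \<Rightarrow> 'k::field mpoly" where
  "var i = mon_poly (Poly_Mapping.single i 1)"

definition scale :: "'k::field \<Rightarrow> 'k mpoly \<Rightarrow> 'k mpoly" where
  "scale c p = Poly_Mapping.map ((*) c) p"

global_interpretation mpoly: vector_space "scale :: 'k::field \<Rightarrow> 'k mpoly \<Rightarrow> 'k mpoly"
proof
  have scale: "scale c p = Poly_Mapping.single 0 c * p" for c :: 'k and p
    unfolding scale_def by (rule mult_map_scale_conv_mult)
  fix a b :: 'k and x y :: "'k mpoly"
  show "scale a (x + y) = scale a x + scale a y"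
    unfolding scale by (rule distrib_left)
  show "scale (a + b) x = scale a x + scale b x"
    unfolding scale by (simp only: single_add distrib_right)
  show "scale a (scale b x) = scale (a * b) x"
    unfolding scale mult.assoc[symmetric] mult_single by simp
  show "scale 1 x = x"
    unfolding scale by simp
qed

lemma poly_ring_cring: "cring (poly_ring n :: 'k::field mpoly ring)"
proof -
  let ?R = "poly_ring n :: 'k mpoly ring"
  have sum_keys: "Poly_Mapping.keys (a + b) \<subseteq> {1..n}"
    if "Poly_Mapping.keys a \<subseteq> {1..n}" "Poly_Mapping.keys b \<subseteq> {1..n}" for a b :: "nat \<Rightarrow>\<^sub>0 nat"
    using that keys_add[of a b] by (meson Un_least subset_trans)
  have add: "p + q \<in> carrier ?R" if "p \<in> carrier ?R" "q \<in> carrier ?R" for p q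
  proof -
    have "Poly_Mapping.keys w \<subseteq> {1..n}" if "w \<in> Poly_Mapping.keys (p + q)" for w
    proof -
      have "w \<in> Poly_Mapping.keys p \<union> Poly_Mapping.keys q"
        using that keys_add[of p q] by (rule rev_subsetD)
      then show ?thesis
        using \<open>p \<in> carrier ?R\<close> \<open>q \<in> carrier ?R\<close> unfolding poly_ring_def
        by (elim UnE) simp_all
    qed
    then show ?thesis by (simp add: poly_ring_def)
  qed
  have mult: "p * q \<in> carrier ?R" if "p \<in> carrier ?R" "q \<in> carrier ?R" for p q
  proof -
    have "Poly_Mapping.keys w \<subseteq> {1..n}" if w: "w \<in> Poly_Mapping.keys (p * q)" for w
    proof -
      obtain a b where ab: "a \<in> Poly_Mapping.keys p" "b \<in> Poly_Mapping.keys q" and w: "w = a + b"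
        using w keys_mult[of p q] by blast
      show ?thesis
        unfolding w by (rule sum_keys)
          (use ab \<open>p \<in> carrier ?R\<close> \<open>q \<in> carrier ?R\<close> in \<open>simp_all add: poly_ring_def\<close>)
    qed
    then show ?thesis by (simp add: poly_ring_def)
  qed
  have uminus: "- p \<in> carrier ?R" if "p \<in> carrier ?R" for p
    using that by (simp add: poly_ring_def)
  have ops: "monoid.mult ?R = (*)" "monoid.one ?R = 1" "ring.zero ?R = 0" "ring.add ?R = (+)"
    by (simp_all add: poly_ring_def)
  have zero: "0 \<in> carrier ?R" and one: "1 \<in> carrier ?R"
    by (simp_all add: poly_ring_def)
  show ?thesis
  proof (rule cringI)
    show "abelian_group ?R"
    proof (rule abelian_groupI, unfold ops)
      show "\<exists>y\<in>carrier ?R. y + x = 0" if "x \<in> carrier ?R" for x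
        using uminus[OF that] by (intro bexI[of _ "- x"]) simp_all
    qed (rule add zero add.assoc add.commute add_0_left; assumption)+
    show "Group.comm_monoid ?R"
      by (rule comm_monoidI, unfold ops)
        (rule mult one mult.assoc mult.commute mult_1_left; assumption)+
  qed (unfold ops, rule distrib_right)
qed

definition monomial_ideal :: "nat \<Rightarrow> (nat \<Rightarrow>\<^sub>0 nat) set \<Rightarrow> 'k::field mpoly set" where
  "monomial_ideal n L = Idl\<^bsub>poly_ring n\<^esub> (mon_poly ` L)"

definition completely_lexsegment_ideal :: "nat \<Rightarrow> 'k::field mpoly set \<Rightarrow> bool" where
  "completely_lexsegment_ideal n I \<longleftrightarrow>
     (\<exists>d L. completely_lexsegment_set n d L \<and> I = monomial_ideal n L)"

definition irrelevant_ideal :: "nat \<Rightarrow> 'k::field mpoly set" where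
  "irrelevant_ideal n = Idl\<^bsub>poly_ring n\<^esub> (var ` {1..n})"


section \<open>Graded components, Hilbert function, Gotzmann ideals\<close>

definition graded_component :: "'k::field mpoly set \<Rightarrow> nat \<Rightarrow> 'k mpoly set" where
  "graded_component I j = {f \<in> I. \<forall>w\<in>Poly_Mapping.keys f. mon_degree w = j}"

definition hilbert_function :: "'k::field mpoly set \<Rightarrow> nat \<Rightarrow> nat" where
  "hilbert_function I j = mpoly.dim (graded_component I j)"

definition generated_in_degree :: "nat \<Rightarrow> nat \<Rightarrow> 'k::field mpoly set \<Rightarrow> bool" where
  "generated_in_degree n d I \<longleftrightarrow>
     (\<exists>F. F \<subseteq> graded_component (carrier (poly_ring n)) d \<and> I = Idl\<^bsub>poly_ring n\<^esub> F)"

text \<open>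
  \<open>I\<^sup>l\<^sup>e\<^sup>x\<close>: its component of degree \<open>j\<close> is spanned by the initial lexsegment of cardinality
  \<open>dim\<^sub>k I\<^sub>j\<close>. For a graded ideal \<open>I\<close>, this subspace is an ideal by Macaulay's theorem.
\<close>

definition lex_ideal :: "nat \<Rightarrow> 'k::field mpoly set \<Rightarrow> 'k mpoly set" where
  "lex_ideal n I = mpoly.span (\<Union>j. mon_poly ` initial_lexseg n j (hilbert_function I j))"

text \<open>
  The number of generators of an ideal is the least cardinality of a generating set.
  The ideal \<open>J\<^sub>\<langle>\<^sub>d\<^sub>\<rangle>\<close> is generated by the component of degree \<open>d\<close> of \<open>J\<close>.
\<close>

definition num_generators :: "nat \<Rightarrow> 'k::field mpoly set \<Rightarrow> nat" where
  "num_generators n J =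
     (LEAST r. \<exists>F \<subseteq> carrier (poly_ring n). finite F \<and> card F = r \<and> Idl\<^bsub>poly_ring n\<^esub> F = J)"

definition component_ideal :: "nat \<Rightarrow> 'k::field mpoly set \<Rightarrow> nat \<Rightarrow> 'k mpoly set" where
  "component_ideal n J d = Idl\<^bsub>poly_ring n\<^esub> (graded_component J d)"

definition gotzmann :: "nat \<Rightarrow> 'k::field mpoly set \<Rightarrow> bool" where
  "gotzmann n I \<longleftrightarrow>
     (\<exists>d. generated_in_degree n d I \<and>
          num_generators n (irrelevant_ideal n \<cdot>\<^bsub>poly_ring n\<^esub> I) =
          num_generators n (irrelevant_ideal n \<cdot>\<^bsub>poly_ring n\<^esub> component_ideal n (lex_ideal n I) d))"

end

theory Submission
  imports Defs
begin

text \<open>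
  The ideals \<open>(x\<^sub>1,\<dots>,x\<^sub>n) I\<close> and \<open>(x\<^sub>1,\<dots>,x\<^sub>n) (I\<^sup>l\<^sup>e\<^sup>x)\<^sub>\<langle>\<^sub>d\<^sub>\<rangle>\<close> are generated by monomials of degree
  \<open>d + 1\<close>, namely the shadows of \<open>L = \<L>(u,v)\<close> and of the initial lexsegment with as many elements.
  So \<open>I\<close> is Gotzmann if and only if these two shadows are equally large
  (\<open>gotzmann_monomial_ideal_iff\<close>). By Macaulay's theorem (\<open>macaulay\<close>), initial lexsegments have the
  smallest shadows, so \<open>L\<close> must not have any competitor of the same size with a smaller shadow.

  Macaulay's theorem is proved by induction on the set of variables. Replacing, for one variable
  \<open>x\<^sub>j\<close>, the elements with each fixed exponent of \<open>x\<^sub>j\<close> by an initial segment does not enlarge the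
  shadow. With at least three variables, a set that no such compression changes is closed under
  replacing variables by larger ones, and for such a set the shadow is governed by its elements without the last
  variable (\<open>card_shadow_on_stable\<close>).

  Now let \<open>a\<close> and \<open>b\<close> be the exponents of \<open>x\<^sub>1\<close> in \<open>u\<close> and \<open>v\<close>. If \<open>a \<ge> b + 2\<close>, then \<open>L\<close> is a completely
  lexsegment set. If \<open>a = b + 1\<close>, then \<open>L\<close> consists of a lower segment of the monomials with
  exponent \<open>b + 1\<close> and an upper segment of those with exponent \<open>b\<close>. Compressing the lower segment
  makes the shadow smaller unless the shadow of \<open>L\<close> contains all monomials with exponent
  \<open>b + 1\<close>, and in that case \<open>L\<close> is again completely lexsegment (\<open>two_slices_cover\<close>). If \<open>a = b\<close>, then
  \<open>L\<close> is \<open>x\<^sub>1\<^sup>a\<close> times a set of monomials without \<open>x\<^sub>1\<close>. When it has more than \<open>n\<close> elements, bringing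
  in a multiple of \<open>x\<^sub>1\<^sup>a\<^sup>+\<^sup>1\<close> yields a smaller shadow (\<open>exists_smaller_shadow_of_slice\<close>). When it has
  \<open>r \<le> n\<close> elements, the minimal size of the shadow is \<open>n + (n - 1) + \<dots> + (n - r + 1)\<close>, because two
  monomials have at most one common multiple in the next degree, and this size is attained
  precisely by products of one monomial with distinct variables (\<open>star_of_card_shadow_on_eq\<close>). In a
  lexsegment these variables are consecutive.
\<close>

section \<open>Initial segments of a finite linear order\<close>

text \<open>
  Initial segments start at the top, as in an initial lexsegment: they are closed upwards in \<open>X\<close>.
\<close>
definition upset_in :: "'a::linorder set \<Rightarrow> 'a set \<Rightarrow> bool" where
  "upset_in X C \<longleftrightarrow> C \<subseteq> X \<and> (\<forall>w\<in>C. \<forall>z\<in>X. w < z \<longrightarrow> z \<in> C)"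

definition top_set :: "'a::linorder set \<Rightarrow> nat \<Rightarrow> 'a set" where
  "top_set X r = {w \<in> X. card {w' \<in> X. w < w'} < r}"

lemma upset_inD: "upset_in X C \<Longrightarrow> w \<in> C \<Longrightarrow> z \<in> X \<Longrightarrow> w \<le> z \<Longrightarrow> z \<in> C"
  unfolding upset_in_def by (metis order_le_less)

lemma upset_in_subset: "upset_in X C \<Longrightarrow> C \<subseteq> X"
  by (simp add: upset_in_def)

lemma upset_in_comparable:
  assumes "upset_in X C" "upset_in X D" shows "C \<subseteq> D \<or> D \<subseteq> C"
proof (rule ccontr)
  assume "\<not> ?thesis"
  then obtain x y where "x \<in> C" "x \<notin> D" "y \<in> D" "y \<notin> C" by blast
  then show False
    using assms upset_inD[of X C x y] upset_inD[of X D y x] upset_in_subset by (metis linear subsetD)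
qed

lemma upset_in_subset_if_card_le:
  assumes "finite X" "upset_in X C" "upset_in X D" "card C \<le> card D" shows "C \<subseteq> D"
  by (metis assms card_seteq finite_subset subset_refl upset_in_comparable upset_in_subset)

lemma card_Un_upset_in:
  assumes "finite X" "upset_in X C" "upset_in X D" shows "card (C \<union> D) = max (card C) (card D)"
proof -
  have "finite C" "finite D" using assms upset_in_subset finite_subset by metis+
  then show ?thesis
    using upset_in_comparable[OF assms(2,3)] card_mono[of C D] card_mono[of D C]
    by (elim disjE) (simp_all add: sup.absorb1 sup.absorb2 max_def)
qed

lemma upset_in_top_set:
  assumes "finite X" shows "upset_in X (top_set X r)"
proof -
  have "card {w' \<in> X. z < w'} \<le> card {w' \<in> X. w < w'}" if "w < z" for w z
    using assms that by (intro card_mono) auto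
  then show ?thesis unfolding upset_in_def top_set_def by fastforce
qed

text \<open>
  The map sending \<open>w\<close> to the number of larger elements is a bijection from \<open>X\<close> to
  \<open>{..<card X}\<close>, under which \<open>top_set X r\<close> is the preimage of \<open>{..<r}\<close>.
\<close>
lemma card_top_set:
  assumes X: "finite X" and r: "r \<le> card X" shows "card (top_set X r) = r"
proof -
  define f where "f w = card {w' \<in> X. w < w'}" for w
  have less: "f z < f w" if "w < z" "z \<in> X" for w z
    unfolding f_def using X that by (intro psubset_card_mono) auto
  have inj: "inj_on f X"
    by (rule inj_onI) (metis less less_irrefl linorder_neqE)
  have "f ` X \<subseteq> {..<card X}"
    unfolding f_def using X by (auto intro!: psubset_card_mono)
  then have im: "f ` X = {..<card X}"
    using inj by (intro card_subset_eq) (auto simp: card_image)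
  have "f ` top_set X r = {..<r}"
    using im r unfolding top_set_def f_def[symmetric] by (auto simp: set_eq_iff image_iff) (metis le_trans lessThan_iff less_le_trans)
  moreover have "inj_on f (top_set X r)"
    using inj by (rule inj_on_subset) (auto simp: top_set_def)
  ultimately show ?thesis by (metis card_image card_lessThan)
qed

text \<open>
  Every element of \<open>I - C\<close> lies above every element of \<open>C - I\<close>, and these two sets are equally
  large. Summing ranks therefore detects whether a set is an initial segment.
\<close>
lemma sum_less_sum_upset_in:
  fixes f :: "'a::linorder \<Rightarrow> nat"
  assumes X: "finite X" and I: "upset_in X I" and C: "C \<subseteq> X" and card: "card C = card I"
    and ne: "C \<noteq> I" and f: "\<And>x y. x \<in> X \<Longrightarrow> y \<in> X \<Longrightarrow> x < y \<Longrightarrow> f x < f y"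
  shows "sum f C < sum f I"
proof -
  have fin: "finite C" "finite I" using X C I finite_subset upset_in_subset by metis+
  have cd: "card (C - I) = card (I - C)"
    using fin card by (metis card_Diff_subset_Int finite_Int inf_commute)
  have "C - I \<noteq> {}"
    using card_seteq[of I C] fin card ne by auto
  define m where "m = Max (C - I)"
  have m: "m \<in> C - I" "\<And>y. y \<in> C - I \<Longrightarrow> y \<le> m"
    unfolding m_def using fin \<open>C - I \<noteq> {}\<close> Max_in[of "C - I"] Max_ge[of "C - I"] by simp_all
  have "f y \<le> f m" if "y \<in> C - I" for y
    using m f[of y m] that C by (metis DiffD1 order.order_iff_strict subsetD)
  then have le: "sum f (C - I) \<le> card (C - I) * f m"
    using sum_bounded_above[of "C - I" f "f m"] by simp
  have "f m + 1 \<le> f x" if "x \<in> I - C" for x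
  proof -
    have "m < x" using upset_inD[OF I, of x m] that m C by (metis DiffD1 DiffD2 linorder_not_le subsetD)
    then show ?thesis using f[of m x] that m C upset_in_subset[OF I] by (metis DiffD1 Suc_eq_plus1 Suc_leI subsetD)
  qed
  then have ge: "card (I - C) * (f m + 1) \<le> sum f (I - C)"
    using sum_bounded_below[of "I - C" "f m + 1" f] by simp
  have "card (C - I) > 0" using \<open>C - I \<noteq> {}\<close> fin by (simp add: card_gt_0_iff)
  then have "sum f (C - I) < sum f (I - C)" using le ge cd by simp
  moreover have "sum f C = sum f (C \<inter> I) + sum f (C - I)" "sum f I = sum f (C \<inter> I) + sum f (I - C)"
    using fin sum.Int_Diff[of C f I] sum.Int_Diff[of I f C] by (simp_all add: inf_commute)
  ultimately show ?thesis by simp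
qed

section \<open>Monomials and their shadows\<close>

definition xvar :: "nat \<Rightarrow> nat \<Rightarrow>\<^sub>0 nat" where "xvar i = Poly_Mapping.single i 1"

abbreviation (input) expo :: "(nat \<Rightarrow>\<^sub>0 nat) \<Rightarrow> nat \<Rightarrow> nat" where "expo \<equiv> Poly_Mapping.lookup"

text \<open>
  Shadows are taken with respect to an arbitrary finite set \<open>V\<close> of variables, because Macaulay's
  theorem is proved by induction on this set, and any of its variables may have to be removed.
\<close>
definition mons :: "nat set \<Rightarrow> nat \<Rightarrow> (nat \<Rightarrow>\<^sub>0 nat) set" where
  "mons V d = {w. Poly_Mapping.keys w \<subseteq> V \<and> mon_degree w = d}"

definition shadow_on :: "nat set \<Rightarrow> (nat \<Rightarrow>\<^sub>0 nat) set \<Rightarrow> (nat \<Rightarrow>\<^sub>0 nat) set" where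
  "shadow_on V C = (\<Union>i\<in>V. (+) (xvar i) ` C)"

lemma Mon_eq_mons: "Mon n d = mons {1..n} d"
  by (simp add: Mon_def mons_def)

lemma shadow_eq_shadow_on: "shadow n C = shadow_on {1..n} C"
  unfolding shadow_def shadow_on_def xvar_def by blast

lemma expo_xvar [simp]: "expo (xvar i) j = (if i = j then 1 else 0)"
  by (simp add: xvar_def lookup_single when_def)

lemma keys_xvar [simp]: "Poly_Mapping.keys (xvar i) = {i}"
  by (simp add: xvar_def)

lemma mon_less_iff: "w < z \<longleftrightarrow> (\<exists>k. expo w k < expo z k \<and> (\<forall>k'<k. expo w k' = expo z k'))"
  by (simp add: less_poly_mapping.rep_eq less_fun_def)

lemma mon_degree_eq_sum:
  assumes "finite V" "Poly_Mapping.keys w \<subseteq> V" shows "mon_degree w = sum (expo w) V"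
  unfolding mon_degree_def using assms
  by (intro sum.mono_neutral_left) (auto simp: in_keys_iff)

lemma mons_iff:
  assumes "finite V"
  shows "w \<in> mons V d \<longleftrightarrow> (\<forall>i. i \<notin> V \<longrightarrow> expo w i = 0) \<and> sum (expo w) V = d"
proof -
  have "Poly_Mapping.keys w \<subseteq> V \<longleftrightarrow> (\<forall>i. i \<notin> V \<longrightarrow> expo w i = 0)"
    by (auto simp: in_keys_iff)
  then show ?thesis
    using mon_degree_eq_sum[OF assms, of w] by (auto simp: mons_def)
qed

lemma mon_degree_add: "mon_degree (w + z) = mon_degree w + mon_degree z"
proof -
  let ?V = "Poly_Mapping.keys w \<union> Poly_Mapping.keys z"
  have "Poly_Mapping.keys (w + z) \<subseteq> ?V" by (rule keys_add)
  then show ?thesis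
    by (simp add: mon_degree_eq_sum[of ?V] lookup_add sum.distrib)
qed

lemma mon_degree_xvar [simp]: "mon_degree (xvar i) = 1"
  by (simp add: mon_degree_def xvar_def)

lemma mon_degree_single [simp]: "mon_degree (Poly_Mapping.single i e) = e"
  by (simp add: mon_degree_def)

lemma keys_mon_add: "Poly_Mapping.keys (w + z) = Poly_Mapping.keys w \<union> Poly_Mapping.keys (z :: nat \<Rightarrow>\<^sub>0 nat)"
  by (auto simp: in_keys_iff lookup_add)

lemma mon_add_mons_iff:
  "w + z \<in> mons V d \<longleftrightarrow> Poly_Mapping.keys w \<subseteq> V \<and> mon_degree w \<le> d \<and> z \<in> mons V (d - mon_degree w)"
  by (auto simp: mons_def keys_mon_add mon_degree_add)

lemma xvar_mons_iff: "xvar i + z \<in> mons V (Suc d) \<longleftrightarrow> i \<in> V \<and> z \<in> mons V d"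
  by (simp add: mon_add_mons_iff)

lemma mon_factor_single:
  assumes "e \<le> expo w i" obtains z where "w = Poly_Mapping.single i e + z"
proof
  show "w = Poly_Mapping.single i e + (w - Poly_Mapping.single i e)"
    using assms by (intro poly_mapping_eqI) (auto simp: lookup_add lookup_minus lookup_single when_def)
qed

lemma mon_factor_xvar:
  assumes "0 < expo w i" obtains z where "w = xvar i + z"
  using assms mon_factor_single[of 1 w i] by (metis One_nat_def Suc_leI xvar_def)

lemma xvar_add_less_iff: "xvar i + z < xvar j + z \<longleftrightarrow> j < i"
proof -
  have "xvar i < xvar j \<longleftrightarrow> j < i"
    unfolding mon_less_iff by (auto split: if_splits intro: exI[of _ j])
  then show ?thesis by simp
qed

lemma finite_mons:
  assumes "finite V" shows "finite (mons V d)"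
proof -
  have "finite {f. \<forall>x. (x \<in> V \<longrightarrow> f x \<in> {..d}) \<and> (x \<notin> V \<longrightarrow> f x = (0::nat))}"
    using assms by (rule finite_set_of_finite_funs) simp
  moreover have "expo ` mons V d \<subseteq> {f. \<forall>x. (x \<in> V \<longrightarrow> f x \<in> {..d}) \<and> (x \<notin> V \<longrightarrow> f x = 0)}"
    using assms by (auto simp: mons_iff intro: member_le_sum)
  ultimately have "finite (expo ` mons V d)" by (rule rev_finite_subset)
  moreover have "inj_on expo (mons V d)" by (simp add: inj_on_def lookup_inject)
  ultimately show ?thesis by (rule finite_imageD)
qed

lemma shadow_onI: "i \<in> V \<Longrightarrow> w \<in> C \<Longrightarrow> xvar i + w \<in> shadow_on V C"
  by (auto simp: shadow_on_def)

lemma shadow_onE: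
  assumes "z \<in> shadow_on V C" obtains i w where "z = xvar i + w" "i \<in> V" "w \<in> C"
  using assms by (auto simp: shadow_on_def)

lemma shadow_on_mons: "C \<subseteq> mons V d \<Longrightarrow> shadow_on V C \<subseteq> mons V (Suc d)"
  by (auto elim!: shadow_onE simp: xvar_mons_iff)

lemma shadow_on_mono: "C \<subseteq> D \<Longrightarrow> shadow_on V C \<subseteq> shadow_on V D"
  by (auto simp: shadow_on_def)

lemma shadow_on_Un: "shadow_on V (C \<union> D) = shadow_on V C \<union> shadow_on V D"
  by (auto simp: shadow_on_def)

lemma shadow_on_empty [simp]: "shadow_on V {} = {}"
  by (simp add: shadow_on_def)

lemma finite_shadow_on: "finite V \<Longrightarrow> finite C \<Longrightarrow> finite (shadow_on V C)"
  by (simp add: shadow_on_def)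

lemma shadow_on_translate: "shadow_on V ((+) m ` C) = (+) m ` shadow_on V C"
  unfolding shadow_on_def image_UN image_image by (simp add: add.left_commute)

lemma card_translate: "card ((+) m ` C) = card (C :: (nat \<Rightarrow>\<^sub>0 nat) set)"
  by (simp add: card_image)

text \<open>
  The factor to remove from \<open>w\<close> is its smallest variable: this disturbs the lexicographic order
  the least. Since \<open>x\<^sub>N v\<close> is the smallest multiple of \<open>v\<close> in the next degree, the lemma says that
  every monomial above it lies in the shadow of an initial segment containing \<open>v\<close>.
\<close>
lemma factor_above:
  assumes V: "finite V" "N \<in> V" "\<And>i. i \<in> V \<Longrightarrow> i \<le> N"
    and v: "v \<in> mons V d" and w: "w \<in> mons V (Suc d)" and le: "xvar N + v \<le> w"
  obtains k z where "k \<in> V" "w = xvar k + z" "z \<in> mons V d" "v \<le> z"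
proof -
  let ?S = "{i \<in> V. 0 < expo w i}"
  define k where "k = Max ?S"
  have "sum (expo w) V \<noteq> 0" using w V by (simp add: mons_iff)
  then have "?S \<noteq> {}" by (metis (mono_tags, lifting) empty_iff gr_zeroI mem_Collect_eq sum.neutral)
  then have k: "k \<in> ?S" "\<And>i. i \<in> ?S \<Longrightarrow> i \<le> k"
    unfolding k_def using V Max_in[of ?S] by simp_all
  obtain z where z: "w = xvar k + z" using k mon_factor_xvar by blast
  have zm: "z \<in> mons V d" using w z xvar_mons_iff by metis
  have "v \<le> z"
  proof (rule ccontr)
    assume "\<not> v \<le> z"
    then obtain i where i: "expo z i < expo v i" "\<And>j. j < i \<Longrightarrow> expo z j = expo v j"
      by (auto simp: not_le mon_less_iff)
    have iV: "i \<in> V" using i v V mons_iff by (metis not_less_zero)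
    have deg: "sum (expo z) V = sum (expo v) V" using v zm V mons_iff by metis
    have "k > i"
    proof (rule ccontr)
      assume "\<not> k > i"
      \<comment> \<open>otherwise \<open>z\<close> vanishes beyond \<open>i\<close>, so its degree is smaller than that of \<open>v\<close>\<close>
      have "expo z j \<le> expo v j" if "j \<in> V" for j
      proof (cases "j < i")
        case False
        have "expo z j = 0" if "j > i"
          using k(2)[of j] \<open>j \<in> V\<close> that \<open>\<not> k > i\<close> unfolding z by (auto simp: lookup_add)
        then show ?thesis using i False by (metis le0 less_or_eq_imp_le linorder_neqE_nat)
      qed (simp add: i)
      then have "sum (expo z) V < sum (expo v) V" using V iV i(1) by (intro sum_strict_mono_ex1) auto
      then show False using deg by simp
    qed
    then have "i < N" using k V by force
    then have "w < xvar N + v"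
      unfolding mon_less_iff z using i \<open>k > i\<close> by (intro exI[of _ i]) (auto simp: lookup_add)
    then show False using le by simp
  qed
  then show thesis using that k z zm by blast
qed

text \<open>
  The least product of \<open>w\<close> with a variable is \<open>x\<^sub>N w\<close> for the last variable \<open>x\<^sub>N\<close>, and everything above
  it can be divided by a variable without falling below \<open>w\<close>.
\<close>
lemma upset_in_shadow_on:
  assumes V: "finite V" and C: "upset_in (mons V d) C"
  shows "upset_in (mons V (Suc d)) (shadow_on V C)"
  unfolding upset_in_def
proof (intro conjI ballI impI)
  show "shadow_on V C \<subseteq> mons V (Suc d)" using C shadow_on_mons upset_in_subset by blast
  fix w z assume w: "w \<in> shadow_on V C" and z: "z \<in> mons V (Suc d)" "w < z"
  obtain i w' where i: "w = xvar i + w'" "i \<in> V" "w' \<in> C" using w by (rule shadow_onE)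
  have N: "Max V \<in> V" "\<And>i. i \<in> V \<Longrightarrow> i \<le> Max V" using V i by (auto intro: Max_in)
  have "xvar (Max V) + w' \<le> xvar i + w'"
    using N(2)[OF i(2)] xvar_add_less_iff by (metis le_less order_refl)
  then have "xvar (Max V) + w' \<le> z" using z(2) unfolding i(1) by (rule order_trans[OF _ less_imp_le])
  moreover have "w' \<in> mons V d" using i C upset_in_subset by blast
  ultimately obtain k z' where "k \<in> V" "z = xvar k + z'" "z' \<in> mons V d" "w' \<le> z'"
    using factor_above[OF V N] z by metis
  then show "z \<in> shadow_on V C" using upset_inD[OF C i(3)] shadow_onI by metis
qed

section \<open>Shadows of exchange-stable sets\<close>

text \<open>
  In a set closed under replacing \<open>x\<^sub>N\<close> by another variable, \<open>x\<^sub>i w\<close> with \<open>x\<^sub>N\<close> dividing \<open>w\<close> equals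
  \<open>x\<^sub>N\<close> times another element of the set. So the shadow consists of the translate by \<open>x\<^sub>N\<close> and of
  the shadow, in the remaining variables, of the elements without \<open>x\<^sub>N\<close>.
\<close>
lemma card_shadow_on_stable:
  assumes V: "finite V" "N \<in> V" and C: "finite C"
    and stable: "\<And>i z. i \<in> V - {N} \<Longrightarrow> xvar N + z \<in> C \<Longrightarrow> xvar i + z \<in> C"
  shows "card (shadow_on V C) = card (shadow_on (V - {N}) {w \<in> C. expo w N = 0}) + card C"
proof -
  let ?S = "shadow_on (V - {N}) {w \<in> C. expo w N = 0}"
  have "shadow_on V C \<subseteq> ?S \<union> (+) (xvar N) ` C"
  proof
    fix y assume "y \<in> shadow_on V C"
    then obtain i w where y: "y = xvar i + w" "i \<in> V" "w \<in> C" by (rule shadow_onE)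
    show "y \<in> ?S \<union> (+) (xvar N) ` C"
    proof (cases "i = N \<or> expo w N = 0")
      case True
      then show ?thesis using y by (auto intro!: shadow_onI)
    next
      case False
      then obtain z where z: "w = xvar N + z" using mon_factor_xvar by blast
      then have "xvar i + z \<in> C" using stable y False by blast
      then show ?thesis unfolding y z by (auto simp: add.left_commute)
    qed
  qed
  moreover have "?S \<union> (+) (xvar N) ` C \<subseteq> shadow_on V C"
    using V by (auto simp: shadow_on_def)
  ultimately have eq: "shadow_on V C = ?S \<union> (+) (xvar N) ` C" by blast
  have disj: "?S \<inter> (+) (xvar N) ` C = {}"
  proof -
    have "xvar i + w \<noteq> xvar N + c" if "i \<noteq> N" "expo w N = 0" for i w c
      using that by (metis add_is_0 expo_xvar lookup_add zero_neq_one)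
    then show ?thesis by (auto simp: shadow_on_def) (metis (no_types))
  qed
  show ?thesis
    unfolding eq using V C disj
    by (subst card_Un_disjoint) (auto intro!: finite_shadow_on simp: card_translate)
qed

lemma upset_in_exchange:
  assumes "upset_in (mons V d) D" "i \<in> V" "i \<le> j" "xvar j + z \<in> D"
  shows "xvar i + z \<in> D"
proof -
  have "xvar j + z \<in> mons V d" using assms upset_in_subset by blast
  then have "xvar i + z \<in> mons V d" using assms(2) by (simp add: mon_add_mons_iff)
  moreover have "xvar j + z \<le> xvar i + z" using xvar_add_less_iff[of j z i] assms(3) by (metis le_less)
  ultimately show ?thesis using upset_inD assms by metis
qed

text \<open>
  The translate by the larger variable \<open>x\<^sub>i\<close> misses the product of \<open>x\<^sub>j\<close> with the least element.
\<close>
lemma card_shadow_on_gt: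
  assumes V: "finite V" "i \<in> V" "j \<in> V" "i < j" and C: "finite C" "C \<noteq> {}"
  shows "card C < card (shadow_on V C)"
proof -
  let ?y = "xvar j + Min C"
  have min: "Min C \<in> C" using C by (rule Min_in)
  have "?y \<noteq> xvar i + c" if "c \<in> C" for c
  proof -
    have "?y \<le> xvar j + c" using that C by simp
    also have "\<dots> < xvar i + c" using xvar_add_less_iff V by blast
    finally show ?thesis by simp
  qed
  then have "card (insert ?y ((+) (xvar i) ` C)) = Suc (card C)"
    using C by (subst card_insert_disjoint) (auto simp: card_translate)
  moreover have "insert ?y ((+) (xvar i) ` C) \<subseteq> shadow_on V C"
    using V min by (auto intro!: shadow_onI)
  ultimately show ?thesis
    using card_mono[of "shadow_on V C" "insert ?y ((+) (xvar i) ` C)"] finite_shadow_on V C by simp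
qed

section \<open>Slices and compression\<close>

text \<open>
  The conclusion of Macaulay's theorem for the variables in \<open>V\<close>, named because it serves as the
  induction hypothesis for \<open>V - {j}\<close>, in all degrees at once.
\<close>
definition macaulay_on :: "nat set \<Rightarrow> bool" where
  "macaulay_on V \<longleftrightarrow> (\<forall>d C D. C \<subseteq> mons V d \<longrightarrow> upset_in (mons V d) D \<longrightarrow> card D \<le> card C \<longrightarrow>
     card (shadow_on V D) \<le> card (shadow_on V C))"

text \<open>
  The exponent \<open>e\<close> is kept, instead of dividing by \<open>x\<^sub>j\<^sup>e\<close>, so that the slices of a set are
  disjoint subsets of it and its size is the sum of theirs.
\<close>
definition slice :: "nat \<Rightarrow> nat \<Rightarrow> (nat \<Rightarrow>\<^sub>0 nat) set \<Rightarrow> (nat \<Rightarrow>\<^sub>0 nat) set" where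
  "slice j e C = {w \<in> C. expo w j = e}"

lemma slice_mono: "C \<subseteq> D \<Longrightarrow> slice j e C \<subseteq> slice j e D"
  by (auto simp: slice_def)

lemma expo_le_degree: "finite V \<Longrightarrow> w \<in> mons V d \<Longrightarrow> expo w j \<le> d"
  by (cases "j \<in> V") (auto simp: mons_iff intro: member_le_sum)

lemma slice_mons:
  assumes "j \<in> V" "e \<le> d"
  shows "slice j e (mons V d) = (+) (Poly_Mapping.single j e) ` mons (V - {j}) (d - e)"
proof -
  have 1: "Poly_Mapping.single j e + z \<in> slice j e (mons V d)" if "z \<in> mons (V - {j}) (d - e)" for z
    using that assms unfolding slice_def
    by (auto simp: mon_add_mons_iff lookup_add in_keys_iff mons_def lookup_single when_def mon_degree_add subset_iff split: if_splits)
  have 2: "w \<in> (+) (Poly_Mapping.single j e) ` mons (V - {j}) (d - e)" if "w \<in> slice j e (mons V d)" for w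
  proof -
    have "expo w j = e" using that by (simp add: slice_def)
    then obtain z where z: "w = Poly_Mapping.single j e + z" using mon_factor_single[of e w j] by auto
    then have "z \<in> mons V (d - e)" "expo z j = 0"
      using that \<open>expo w j = e\<close> by (auto simp: slice_def mon_add_mons_iff lookup_add)
    then have "z \<in> mons (V - {j}) (d - e)"
      unfolding mons_def by (auto simp: in_keys_iff)
    then show ?thesis using z by blast
  qed
  show ?thesis using 1 2 by blast
qed

lemma slice_mons_Suc:
  assumes "j \<in> V"
  shows "slice j (Suc e) (mons V (Suc d)) = (+) (xvar j) ` slice j e (mons V d)"
proof -
  have "w \<in> (+) (xvar j) ` slice j e (mons V d)" if "w \<in> slice j (Suc e) (mons V (Suc d))" for w
  proof -
    have "0 < expo w j" using that by (simp add: slice_def)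
    then obtain z where "w = xvar j + z" by (rule mon_factor_xvar)
    then show ?thesis using that by (auto simp: slice_def xvar_mons_iff lookup_add)
  qed
  then show ?thesis using assms by (auto simp: slice_def xvar_mons_iff lookup_add)
qed

lemma upset_in_translate:
  "upset_in ((+) m ` Y) ((+) m ` D) \<longleftrightarrow> upset_in Y (D :: (nat \<Rightarrow>\<^sub>0 nat) set)"
  by (auto simp: upset_in_def image_iff subset_iff)

text \<open>
  Multiplication by \<open>x\<^sub>j\<^sup>e\<close> preserves the order and commutes with shadows, so the statements about
  monomials in \<open>V - {j}\<close> carry over to slices.
\<close>
lemma macaulay_slice:
  assumes V: "finite V" "j \<in> V" and IH: "macaulay_on (V - {j})"
    and D: "upset_in (slice j e (mons V d)) D"
  shows upset_in_shadow_slice: "upset_in (slice j e (mons V (Suc d))) (shadow_on (V - {j}) D)"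
    and card_shadow_slice_le: "C \<subseteq> slice j e (mons V d) \<Longrightarrow> card D \<le> card C \<Longrightarrow>
      card (shadow_on (V - {j}) D) \<le> card (shadow_on (V - {j}) C)"
proof -
  let ?m = "Poly_Mapping.single j e" and ?U = "V - {j}"
  have *: "upset_in (slice j e (mons V (Suc d))) (shadow_on ?U D) \<and>
     (C \<subseteq> slice j e (mons V d) \<longrightarrow> card D \<le> card C \<longrightarrow> card (shadow_on ?U D) \<le> card (shadow_on ?U C))" for C
  proof (cases "e \<le> d")
    case False
    then have "slice j e (mons V d) = {}"
      using expo_le_degree[OF V(1)] by (fastforce simp: slice_def)
    then have "D = {}" using D upset_in_subset by blast
    then show ?thesis by (simp add: upset_in_def)
  next
    case True
    note sl = slice_mons[OF V(2) True]
    obtain D' where D': "D = (+) ?m ` D'" using upset_in_subset[OF D] sl by (metis subset_image_iff)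
    have uD': "upset_in (mons ?U (d - e)) D'" using D unfolding sl D' upset_in_translate .
    have "upset_in (mons ?U (Suc (d - e))) (shadow_on ?U D')"
      using V uD' by (intro upset_in_shadow_on) auto
    then have "upset_in (slice j e (mons V (Suc d))) (shadow_on ?U D)"
      using slice_mons[OF V(2), of e "Suc d"] True
      unfolding D' shadow_on_translate by (simp add: upset_in_translate Suc_diff_le)
    moreover have "card (shadow_on ?U D) \<le> card (shadow_on ?U C)"
      if C: "C \<subseteq> slice j e (mons V d)" "card D \<le> card C"
    proof -
      obtain C' where C': "C = (+) ?m ` C'" "C' \<subseteq> mons ?U (d - e)"
        using C sl by (metis subset_image_iff)
      have "card D' \<le> card C'" using C(2) unfolding C' D' card_translate .
      then have "card (shadow_on ?U D') \<le> card (shadow_on ?U C')"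
        using IH C' uD' unfolding macaulay_on_def by blast
      then show ?thesis unfolding C' D' shadow_on_translate card_translate .
    qed
    ultimately show ?thesis by blast
  qed
  show "upset_in (slice j e (mons V (Suc d))) (shadow_on ?U D)" using * by blast
  show "C \<subseteq> slice j e (mons V d) \<Longrightarrow> card D \<le> card C \<Longrightarrow>
      card (shadow_on ?U D) \<le> card (shadow_on ?U C)" using * by blast
qed

lemma slice_shadow_on:
  assumes "j \<in> V"
  shows "slice j 0 (shadow_on V C) = shadow_on (V - {j}) (slice j 0 C)"
    and "slice j (Suc e) (shadow_on V C) =
      shadow_on (V - {j}) (slice j (Suc e) C) \<union> (+) (xvar j) ` slice j e C"
proof -
  have split: "y \<in> shadow_on (V - {j}) (slice j (expo y j) C) \<or> (\<exists>w\<in>C. y = xvar j + w)"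
    if "y \<in> shadow_on V C" for y
  proof -
    from that obtain i w where y: "y = xvar i + w" "i \<in> V" "w \<in> C" by (rule shadow_onE)
    then show ?thesis by (cases "i = j") (auto intro!: shadow_onI simp: slice_def lookup_add)
  qed
  have sub: "shadow_on (V - {j}) (slice j e' C) \<subseteq> slice j e' (shadow_on V C)" for e'
    by (auto simp: shadow_on_def slice_def lookup_add)
  have xsub: "(+) (xvar j) ` slice j e C \<subseteq> slice j (Suc e) (shadow_on V C)"
    using assms by (auto simp: shadow_on_def slice_def lookup_add)
  have "slice j 0 (shadow_on V C) \<subseteq> shadow_on (V - {j}) (slice j 0 C)"
    using split by (fastforce simp: slice_def lookup_add)
  then show "slice j 0 (shadow_on V C) = shadow_on (V - {j}) (slice j 0 C)"
    using sub by blast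
  have "y \<in> shadow_on (V - {j}) (slice j (Suc e) C) \<union> (+) (xvar j) ` slice j e C"
    if "y \<in> slice j (Suc e) (shadow_on V C)" for y
  proof -
    have "y \<in> shadow_on V C" "expo y j = Suc e" using that by (simp_all add: slice_def)
    with split[of y] show ?thesis by (auto simp: slice_def lookup_add)
  qed
  then show "slice j (Suc e) (shadow_on V C) =
      shadow_on (V - {j}) (slice j (Suc e) C) \<union> (+) (xvar j) ` slice j e C"
    using sub[of "Suc e"] xsub by blast
qed

lemma sum_slices:
  assumes "finite C" "\<And>w. w \<in> C \<Longrightarrow> expo w j \<le> b"
  shows "(\<Sum>e\<le>b. sum f (slice j e C)) = sum f C"
  unfolding slice_def using assms by (intro sum.group) auto

lemma card_slices:
  assumes "finite C" "\<And>w. w \<in> C \<Longrightarrow> expo w j \<le> b"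
  shows "(\<Sum>e\<le>b. card (slice j e C)) = card C"
  using sum_slices[OF assms, of "\<lambda>_. 1"] unfolding card_eq_sum .

definition compress :: "nat set \<Rightarrow> nat \<Rightarrow> nat \<Rightarrow> (nat \<Rightarrow>\<^sub>0 nat) set \<Rightarrow> (nat \<Rightarrow>\<^sub>0 nat) set" where
  "compress V d j C = (\<Union>e. top_set (slice j e (mons V d)) (card (slice j e C)))"

context
  fixes V d j C
  assumes V: "finite V" "j \<in> V" and C: "C \<subseteq> mons V d"
begin

lemma finite_slice_mons: "finite (slice j e (mons V d'))"
  using finite_mons[OF V(1)] by (simp add: slice_def)

lemma slice_compress: "slice j e (compress V d j C) = top_set (slice j e (mons V d)) (card (slice j e C))"
  unfolding compress_def slice_def top_set_def by auto

lemma compress_mons: "compress V d j C \<subseteq> mons V d"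
  by (auto simp: compress_def top_set_def slice_def)

lemma upset_in_slice_compress: "upset_in (slice j e (mons V d)) (slice j e (compress V d j C))"
  unfolding slice_compress by (intro upset_in_top_set finite_slice_mons)

lemma card_slice_compress: "card (slice j e (compress V d j C)) = card (slice j e C)"
  unfolding slice_compress
  by (intro card_top_set finite_slice_mons card_mono slice_mono C)

lemma card_compress: "card (compress V d j C) = card C"
proof -
  have "finite C" "finite (compress V d j C)"
    using C compress_mons finite_mons[OF V(1)] finite_subset by blast+
  moreover have "expo w j \<le> d" if "w \<in> C \<union> compress V d j C" for w
    using that C compress_mons expo_le_degree[OF V(1)] by blast
  ultimately show ?thesis
    using card_slices[of C j d] card_slices[of "compress V d j C" j d] by (simp add: card_slice_compress)
qed

text \<open>
  A slice of the shadow is the union of the shadow of one slice and a translate of the preceding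
  slice. After compression these are two initial segments of the same order, so their union is only
  as large as the larger of them; before, it was at least that large.
\<close>
lemma card_slice_shadow_compress:
  assumes IH: "macaulay_on (V - {j})"
  shows "card (slice j e (shadow_on V (compress V d j C))) \<le> card (slice j e (shadow_on V C))"
proof -
  let ?K = "compress V d j C" and ?U = "V - {j}"
  have fin: "finite (shadow_on V C)"
    using C finite_mons[OF V(1)] finite_subset finite_shadow_on[OF V(1)] by metis
  have sh: "card (shadow_on ?U (slice j e ?K)) \<le> card (shadow_on ?U (slice j e C))" for e
    using card_shadow_slice_le[OF V IH upset_in_slice_compress] slice_mono[OF C]
    by (simp add: card_slice_compress)
  show ?thesis
  proof (cases e)
    case 0
    then show ?thesis using sh[of 0] by (simp add: slice_shadow_on[OF V(2)])
  next
    case (Suc e')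
    let ?X = "slice j (Suc e') (mons V (Suc d))"
    let ?A = "shadow_on ?U (slice j (Suc e') C)" and ?B = "(+) (xvar j) ` slice j e' C"
    let ?A' = "shadow_on ?U (slice j (Suc e') ?K)" and ?B' = "(+) (xvar j) ` slice j e' ?K"
    have "upset_in ?X ?A'"
      by (rule upset_in_shadow_slice[OF V IH upset_in_slice_compress])
    moreover have "upset_in ?X ?B'"
      unfolding slice_mons_Suc[OF V(2)] upset_in_translate by (rule upset_in_slice_compress)
    ultimately have "card (?A' \<union> ?B') = max (card ?A') (card ?B')"
      by (rule card_Un_upset_in[OF finite_slice_mons])
    also have "\<dots> \<le> max (card ?A) (card ?B)"
      using sh[of "Suc e'"] by (auto simp: card_translate card_slice_compress)
    also have "\<dots> \<le> card (?A \<union> ?B)"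
    proof -
      have "finite (?A \<union> ?B)"
        using fin slice_shadow_on(2)[OF V(2), of e' C] by (metis (no_types, lifting) finite_subset mem_Collect_eq slice_def subsetI)
      then show ?thesis by (simp add: card_mono)
    qed
    finally show ?thesis unfolding Suc slice_shadow_on(2)[OF V(2)] .
  qed
qed

lemma card_shadow_compress:
  assumes IH: "macaulay_on (V - {j})"
  shows "card (shadow_on V (compress V d j C)) \<le> card (shadow_on V C)"
    and "card (slice j e (shadow_on V (compress V d j C))) < card (slice j e (shadow_on V C)) \<Longrightarrow>
      card (shadow_on V (compress V d j C)) < card (shadow_on V C)"
proof -
  let ?K = "compress V d j C"
  have fin: "finite (shadow_on V C)" "finite (shadow_on V ?K)"
    using C compress_mons finite_mons[OF V(1)] finite_subset finite_shadow_on[OF V(1)] by metis+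
  have bd: "expo w j \<le> Suc d" if "w \<in> shadow_on V C \<union> shadow_on V ?K" for w
    using that shadow_on_mons[OF C] shadow_on_mons[OF compress_mons] expo_le_degree[OF V(1)] by blast
  note sl = card_slices[OF fin(1), of j "Suc d"] card_slices[OF fin(2), of j "Suc d"]
  note le = card_slice_shadow_compress[OF IH]
  have "(\<Sum>e\<le>Suc d. card (slice j e (shadow_on V ?K))) \<le> (\<Sum>e\<le>Suc d. card (slice j e (shadow_on V C)))"
    by (intro sum_mono le)
  then show "card (shadow_on V ?K) \<le> card (shadow_on V C)"
    using sl bd by simp
  assume less: "card (slice j e (shadow_on V ?K)) < card (slice j e (shadow_on V C))"
  then have "slice j e (shadow_on V C) \<noteq> {}" by auto
  then have "e \<le> Suc d" using bd by (auto simp: slice_def)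
  then have "(\<Sum>e\<le>Suc d. card (slice j e (shadow_on V ?K))) < (\<Sum>e\<le>Suc d. card (slice j e (shadow_on V C)))"
    using less le by (intro sum_strict_mono_ex1) auto
  then show "card (shadow_on V ?K) < card (shadow_on V C)"
    using sl bd by simp
qed

lemma compress_increases_weight:
  fixes f :: "(nat \<Rightarrow>\<^sub>0 nat) \<Rightarrow> nat"
  assumes f: "\<And>x y. x \<in> mons V d \<Longrightarrow> y \<in> mons V d \<Longrightarrow> x < y \<Longrightarrow> f x < f y"
    and ne: "\<not> upset_in (slice j e (mons V d)) (slice j e C)"
  shows "sum f C < sum f (compress V d j C)"
proof -
  let ?K = "compress V d j C"
  have fin: "finite C" "finite ?K"
    using C compress_mons finite_mons[OF V(1)] finite_subset by blast+
  have bd: "expo w j \<le> d" if "w \<in> C \<union> ?K" for w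
    using that C compress_mons expo_le_degree[OF V(1)] by blast
  have less: "sum f (slice j e' C) < sum f (slice j e' ?K)" if "slice j e' C \<noteq> slice j e' ?K" for e'
  proof (rule sum_less_sum_upset_in[OF finite_slice_mons upset_in_slice_compress slice_mono[OF C] _ that])
    show "card (slice j e' C) = card (slice j e' ?K)" by (simp add: card_slice_compress)
    show "f x < f y" if "x \<in> slice j e' (mons V d)" "y \<in> slice j e' (mons V d)" "x < y" for x y
      using that f by (simp add: slice_def)
  qed
  have e: "slice j e C \<noteq> slice j e ?K" using ne upset_in_slice_compress by metis
  then have "slice j e C \<noteq> {} \<or> slice j e ?K \<noteq> {}" by blast
  then have "e \<le> d" using bd by (fastforce simp: slice_def)
  then have "(\<Sum>e\<le>d. sum f (slice j e C)) < (\<Sum>e\<le>d. sum f (slice j e ?K))"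
  proof (intro sum_strict_mono_ex1 ballI)
    show "sum f (slice j e' C) \<le> sum f (slice j e' ?K)" for e' using less[of e'] by (metis le_less)
    show "\<exists>e\<in>{..d}. sum f (slice j e C) < sum f (slice j e ?K)" using less[OF e] \<open>e \<le> d\<close> by auto
  qed simp
  then show ?thesis
    using sum_slices[OF fin(1), of j d f] sum_slices[OF fin(2), of j d f] bd by simp
qed

end

section \<open>Macaulay's theorem\<close>

text \<open>
  Among the competitors of the same size whose shadow is not larger, one of greatest total rank
  cannot be improved by any compression.
\<close>
lemma exists_compressed:
  assumes V: "finite V" and IH: "\<And>j. j \<in> V \<Longrightarrow> macaulay_on (V - {j})" and C: "C \<subseteq> mons V d"
  obtains K where "K \<subseteq> mons V d" "card K = card C" "card (shadow_on V K) \<le> card (shadow_on V C)"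
    "\<And>j e. j \<in> V \<Longrightarrow> upset_in (slice j e (mons V d)) (slice j e K)"
proof -
  define f where "f w = card {z \<in> mons V d. z < w}" for w
  define F where "F = {K. K \<subseteq> mons V d \<and> card K = card C \<and> card (shadow_on V K) \<le> card (shadow_on V C)}"
  have f: "f x < f y" if "x \<in> mons V d" "y \<in> mons V d" "x < y" for x y
    unfolding f_def using that finite_mons[OF V] by (intro psubset_card_mono) auto
  have "F \<subseteq> Pow (mons V d)" by (auto simp: F_def)
  then have "finite F" using finite_mons[OF V] finite_subset by blast
  moreover have "C \<in> F" using C by (simp add: F_def)
  ultimately obtain K where K: "K \<in> F" "\<And>K'. K' \<in> F \<Longrightarrow> sum f K' \<le> sum f K"
    using Max_in[of "sum f ` F"] Max_ge[of "sum f ` F"] by (metis (no_types, lifting) empty_iff finite_imageI image_iff)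
  have "upset_in (slice j e (mons V d)) (slice j e K)" if j: "j \<in> V" for j e
  proof (rule ccontr)
    assume ne: "\<not> ?thesis"
    have KV: "K \<subseteq> mons V d" using K by (simp add: F_def)
    have "compress V d j K \<in> F"
      using K(1) compress_mons[OF V j KV] card_compress[OF V j KV] card_shadow_compress(1)[OF V j KV IH[OF j]]
      by (simp add: F_def)
    then show False
      using K(2) compress_increases_weight[OF V j KV _ ne, of f] f by (metis not_less)
  qed
  then show thesis using that[of K] K(1) by (simp add: F_def)
qed

text \<open>
  With at least three variables, two monomials that differ by exchanging powers of two variables
  share the exponent of a third one, so a set that is compressed in every direction is closed under
  replacing variables by larger ones. This reduces the comparison of shadows to the elements
  without the last variable \<open>x\<^sub>N\<close>, of which \<open>K\<close> has at least as many as \<open>D\<close>.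
\<close>
lemma macaulay_compressed:
  assumes V: "finite V" "3 \<le> card V" and IH: "macaulay_on (V - {Max V})"
    and K: "K \<subseteq> mons V d" and comp: "\<And>j e. j \<in> V \<Longrightarrow> upset_in (slice j e (mons V d)) (slice j e K)"
    and D: "upset_in (mons V d) D" and card: "card D \<le> card K"
  shows "card (shadow_on V D) \<le> card (shadow_on V K)"
proof -
  define N where "N = Max V"
  define U where "U = V - {N}"
  define M where "M = Max U"
  have N: "N \<in> V" "\<And>i. i \<in> V \<Longrightarrow> i \<le> N" unfolding N_def using V by (auto intro: Max_in)
  have U: "finite U" "card U \<ge> 2" unfolding U_def using V N by auto
  then have M: "M \<in> U" "\<And>i. i \<in> U \<Longrightarrow> i \<le> M" unfolding M_def by (auto intro: Max_in)
  have third: "\<exists>k\<in>V. k \<noteq> N \<and> k \<noteq> i" for i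
  proof -
    have "card (U - {i}) \<ge> 1" using U by (metis (no_types, lifting) Suc_1 Suc_leD card.infinite card_Diff_singleton_if diff_le_mono diff_Suc_1 One_nat_def)
    then have "U - {i} \<noteq> {}" by (metis card.empty not_one_le_zero)
    then show ?thesis unfolding U_def by blast
  qed
  have up: "z \<in> K" if "w \<in> K" "z \<in> mons V d" "j \<in> V" "expo z j = expo w j" "w \<le> z" for w z j
    using upset_inD[OF comp[of j "expo w j"], of w z] that by (auto simp: slice_def)
  have move: "Poly_Mapping.single i e + z \<in> K" if "Poly_Mapping.single N e + z \<in> K" "i \<in> U" for i e z
  proof -
    obtain k where k: "k \<in> V" "k \<noteq> N" "k \<noteq> i" using third by blast
    have "Poly_Mapping.single N e \<le> Poly_Mapping.single i e"
    proof (cases "e = 0")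
      case False
      have "i < N" using N that(2) unfolding U_def by force
      then have "Poly_Mapping.single N e < Poly_Mapping.single i e"
        unfolding mon_less_iff using False by (intro exI[of _ i]) (simp add: lookup_single when_def)
      then show ?thesis by simp
    qed simp
    moreover have "Poly_Mapping.single i e + z \<in> mons V d"
      using that K U_def by (auto simp: mon_add_mons_iff subset_iff split: if_splits)
    ultimately show ?thesis
      using up[OF that(1) _ k(1)] k by (simp add: lookup_add lookup_single when_def)
  qed
  have mU: "mons U d = slice N 0 (mons V d)"
    unfolding U_def slice_def mons_def by (auto simp: in_keys_iff)
  have uK: "upset_in (mons U d) (slice N 0 K)" unfolding mU by (rule comp[OF N(1)])
  have uD: "upset_in (mons U d) (slice N 0 D)"
    unfolding mU using D by (auto simp: upset_in_def slice_def)
  have fin: "finite K" "finite D"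
    using K upset_in_subset[OF D] finite_mons[OF V(1)] finite_subset by blast+
  \<comment> \<open>If \<open>w\<close> lay only in \<open>D\<close>, all of \<open>K\<close> would be strictly above \<open>w\<close>: an element of \<open>K\<close> below
    \<open>w\<close> would stay below \<open>w\<close> after turning its power of \<open>x\<^sub>N\<close> into a power of the neighbouring
    variable \<open>x\<^sub>M\<close>, and would then force \<open>w\<close> into the initial segment \<open>slice N 0 K\<close>. But \<open>D\<close>
    contains everything above \<open>w\<close>, and \<open>w\<close> itself, so it would be larger than \<open>K\<close>.\<close>
  have "slice N 0 D \<subseteq> slice N 0 K"
  proof
    fix w assume w: "w \<in> slice N 0 D"
    show "w \<in> slice N 0 K"
    proof (rule ccontr)
      assume nw: "w \<notin> slice N 0 K"
      have wm: "w \<in> mons U d" using w uD upset_in_subset by blast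
      have "w < z" if z: "z \<in> K" for z
      proof (rule ccontr)
        assume "\<not> w < z"
        obtain y where y: "z = Poly_Mapping.single N (expo z N) + y"
          using mon_factor_single[of "expo z N" z N] by auto
        define z' where "z' = Poly_Mapping.single M (expo z N) + y"
        have y0: "expo y N = 0" using arg_cong[OF y, of "\<lambda>w. expo w N"] by (simp add: lookup_add)
        have "z' \<in> K" using move[of "expo z N" y M] z y M by (simp add: z'_def)
        moreover have "expo z' N = 0" using M y0 by (auto simp: z'_def lookup_add lookup_single when_def U_def)
        ultimately have z'K: "z' \<in> slice N 0 K" by (simp add: slice_def)
        then have z'm: "z' \<in> mons U d" using uK upset_in_subset by blast
        have "\<not> z' \<le> w" using upset_inD[OF uK z'K wm] nw by blast
        then obtain k where k: "expo w k < expo z' k" "\<And>j. j < k \<Longrightarrow> expo w j = expo z' j"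
          by (auto simp: not_le mon_less_iff)
        have kU: "k \<in> U" using k z'm U by (metis mons_iff not_less_zero)
        have "M < N" using M(1) N(2) unfolding U_def by force
        have low: "expo z' j = expo z j" if "j < M" for j
          using that \<open>M < N\<close> arg_cong[OF y, of "\<lambda>w. expo w j"]
          by (simp add: z'_def lookup_add lookup_single when_def)
        show False
        proof (cases "k = M")
          case True
          have "expo w j \<le> expo z' j" if "j \<in> U" for j
            using M(2)[OF that] k True by (cases "j = M") auto
          then have "sum (expo w) U < sum (expo z') U"
            using U kU k(1) by (intro sum_strict_mono_ex1) auto
          then show False using z'm wm U by (simp add: mons_iff)
        next
          case False
          then have "k < M" using M(2)[OF kU] by simp
          then have "w < z" unfolding mon_less_iff using k low by (intro exI[of _ k]) auto
          then show False using \<open>\<not> w < z\<close> by blast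
        qed
      qed
      moreover have "w \<in> D" using w by (simp add: slice_def)
      ultimately have "K \<subset> D"
        using D K unfolding upset_in_def by (metis less_irrefl psubsetI subsetD subsetI)
      then show False using card fin by (meson not_le psubset_card_mono)
    qed
  qed
  then have "card (slice N 0 D) \<le> card (slice N 0 K)" using fin by (intro card_mono) (simp_all add: slice_def)
  then have sU: "card (shadow_on U (slice N 0 D)) \<le> card (shadow_on U (slice N 0 K))"
    using IH uD upset_in_subset[OF uK] unfolding macaulay_on_def N_def[symmetric] U_def[symmetric] by blast
  have "card (shadow_on V D) = card (shadow_on U (slice N 0 D)) + card D"
    unfolding U_def slice_def using upset_in_exchange[OF D] N
    by (intro card_shadow_on_stable V fin) auto
  moreover have "card (shadow_on V K) = card (shadow_on U (slice N 0 K)) + card K"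
    unfolding U_def slice_def using move[of 1]
    by (intro card_shadow_on_stable V fin N) (auto simp: xvar_def U_def)
  ultimately show ?thesis using sU card by simp
qed

lemma card_mons_singleton_le: "card (mons {i} d) \<le> 1"
proof -
  have "w = Poly_Mapping.single i d" if "w \<in> mons {i} d" for w
    using that by (intro poly_mapping_eqI) (auto simp: mons_iff lookup_single when_def)
  then have "mons {i} d \<subseteq> {Poly_Mapping.single i d}" by blast
  from card_mono[OF _ this] show ?thesis by simp
qed

text \<open>
  With two variables, the shadow of a nonempty initial segment has exactly one element more than the
  segment, which is the least possible for any nonempty set.
\<close>
lemma macaulay_on_small:
  assumes V: "finite V" "card V \<le> 2" shows "macaulay_on V"
  unfolding macaulay_on_def
proof (intro allI impI)
  fix d C D assume C: "C \<subseteq> mons V d" and D: "upset_in (mons V d) D" and card: "card D \<le> card C"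
  have fin: "finite C" "finite D"
    using C upset_in_subset[OF D] finite_mons[OF V(1)] finite_subset by blast+
  consider "V = {}" | i where "V = {i}" | i j where "V = {i, j}" "i < j"
  proof -
    consider "card V = 0" | "card V = 1" | "card V = 2" using V by linarith
    then show thesis
    proof cases
      case 1
      then show thesis using that(1) V(1) by simp
    next
      case 2
      then show thesis using that(2) by (auto simp: card_1_singleton_iff)
    next
      case 3
      then obtain i j where "V = {i, j}" "i \<noteq> j" by (auto simp: card_2_iff)
      then show thesis using that(3)[of i j] that(3)[of j i] by (metis insert_commute linorder_neqE_nat)
    qed
  qed
  then show "card (shadow_on V D) \<le> card (shadow_on V C)"
  proof cases
    case 1 then show ?thesis by (simp add: shadow_on_def)
  next
    case 2 then show ?thesis using card by (simp add: shadow_on_def card_translate)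
  next
    case (3 i j)
    show ?thesis
    proof (cases "D = {}")
      case False
      then have "C \<noteq> {}" using card fin by (metis card.empty card_gt_0_iff not_le)
      then have "card C < card (shadow_on V C)" using card_shadow_on_gt[OF V(1), of i j] 3 fin by auto
      moreover have "card (shadow_on V D) = card (shadow_on (V - {j}) (slice j 0 D)) + card D"
        unfolding slice_def using upset_in_exchange[OF D, of i j] 3
        by (intro card_shadow_on_stable V fin) auto
      moreover have "card (shadow_on (V - {j}) (slice j 0 D)) \<le> 1"
      proof -
        have "V - {j} = {i}" using 3 by auto
        have "slice j 0 D \<subseteq> mons {i} d"
          using upset_in_subset[OF D] 3 by (force simp: slice_def mons_iff)
        then have "card (slice j 0 D) \<le> 1"
          using card_mono[OF finite_mons[of "{i}" d], of "slice j 0 D"] card_mons_singleton_le[of i d] by simp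
        then show ?thesis unfolding \<open>V - {j} = {i}\<close> by (simp add: shadow_on_def card_translate)
      qed
      ultimately show ?thesis using card by simp
    qed simp
  qed
qed

theorem macaulay:
  assumes "finite V" shows "macaulay_on V"
  using assms
proof (induction "card V" arbitrary: V rule: less_induct)
  case less
  show ?case
  proof (cases "card V \<le> 2")
    case False
    have IH: "macaulay_on (V - {j})" if "j \<in> V" for j
      using less(1)[of "V - {j}"] less(2) that by (simp add: card_Diff1_less del: card_Diff_insert)
    have "V \<noteq> {}" using False by auto
    then have N: "Max V \<in> V" using less(2) by simp
    show ?thesis
      unfolding macaulay_on_def
    proof (intro allI impI)
      fix d C D assume C: "C \<subseteq> mons V d" and D: "upset_in (mons V d) D" and card: "card D \<le> card C"
      obtain K where K: "K \<subseteq> mons V d" "card K = card C" "card (shadow_on V K) \<le> card (shadow_on V C)"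
        "\<And>j e. j \<in> V \<Longrightarrow> upset_in (slice j e (mons V d)) (slice j e K)"
        using exists_compressed[OF less(2) IH C] by metis
      have "card (shadow_on V D) \<le> card (shadow_on V K)"
        using macaulay_compressed[OF less(2) _ IH[OF N] K(1,4) D] False card K(2) by simp
      then show "card (shadow_on V D) \<le> card (shadow_on V C)" using K(3) by simp
    qed
  qed (use less macaulay_on_small in blast)
qed

section \<open>Sets of at most as many monomials as variables\<close>

text \<open>
  A common multiple of two different monomials in the next degree must be their least common
  multiple.
\<close>
lemma common_multiple_unique:
  assumes "w \<noteq> w'" and "xvar i + w = xvar l + w'" and "xvar i' + w = xvar l' + w'"
  shows "i = i'"
proof (rule ccontr)
  assume "i \<noteq> i'"
  have "i \<noteq> l" using assms by auto
  then have "1 + expo w i = expo w' i"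
    using arg_cong[OF assms(2), of "\<lambda>w. expo w i"] by (simp add: lookup_add)
  moreover have "expo w i = expo (xvar l') i + expo w' i"
    using arg_cong[OF assms(3), of "\<lambda>w. expo w i"] \<open>i \<noteq> i'\<close> by (simp add: lookup_add)
  ultimately show False by simp
qed

definition common_multiples :: "nat set \<Rightarrow> (nat \<Rightarrow>\<^sub>0 nat) \<Rightarrow> (nat \<Rightarrow>\<^sub>0 nat) \<Rightarrow> (nat \<Rightarrow>\<^sub>0 nat) set" where
  "common_multiples V w w' = shadow_on V {w} \<inter> shadow_on V {w'}"

lemma common_multiples_unique:
  assumes "w \<noteq> w'" "y \<in> common_multiples V w w'" "y' \<in> common_multiples V w w'"
  shows "y = y'"
  using assms unfolding common_multiples_def shadow_on_def
  by auto (metis common_multiple_unique)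

lemma card_shadow_on_singleton: "card (shadow_on V {w}) = card V"
proof -
  have "shadow_on V {w} = (\<lambda>i. xvar i + w) ` V" by (auto simp: shadow_on_def)
  moreover have "inj_on (\<lambda>i. xvar i + w) V"
    using xvar_add_less_iff by (intro inj_onI) (metis less_irrefl nat_neq_iff)
  ultimately show ?thesis by (simp add: card_image)
qed

lemma card_shadow_on_insert:
  assumes V: "finite V" and C: "finite C"
  shows "card (shadow_on V (insert w C)) + card (shadow_on V {w} \<inter> shadow_on V C) = card (shadow_on V C) + card V"
proof -
  have "shadow_on V (insert w C) = shadow_on V {w} \<union> shadow_on V C"
    using shadow_on_Un[of V "{w}" C] by simp
  then show ?thesis
    using card_Un_Int[of "shadow_on V {w}" "shadow_on V C"] finite_shadow_on[OF V] C card_shadow_on_singleton[of V w]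
    by simp
qed

text \<open>
  A new monomial shares with the earlier ones at most one element of its shadow per earlier
  monomial. The function \<open>g\<close> records with which one.
\<close>
lemma shadow_overlap_selector:
  assumes w: "w \<notin> C"
  obtains g where "inj_on g (shadow_on V {w} \<inter> shadow_on V C)"
    and "\<And>y. y \<in> shadow_on V {w} \<inter> shadow_on V C \<Longrightarrow> g y \<in> C \<and> y \<in> common_multiples V w (g y)"
proof -
  have "\<forall>y \<in> shadow_on V {w} \<inter> shadow_on V C. \<exists>w'. w' \<in> C \<and> y \<in> common_multiples V w w'"
    by (auto simp: common_multiples_def shadow_on_def)
  then obtain g where g: "\<And>y. y \<in> shadow_on V {w} \<inter> shadow_on V C \<Longrightarrow> g y \<in> C \<and> y \<in> common_multiples V w (g y)"
    by metis
  have "inj_on g (shadow_on V {w} \<inter> shadow_on V C)"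
    by (rule inj_onI) (metis g w common_multiples_unique)
  then show thesis using that g by blast
qed

lemma card_shadow_overlap_le:
  assumes "w \<notin> C" "finite C" shows "card (shadow_on V {w} \<inter> shadow_on V C) \<le> card C"
proof -
  obtain g where "inj_on g (shadow_on V {w} \<inter> shadow_on V C)"
    and "\<And>y. y \<in> shadow_on V {w} \<inter> shadow_on V C \<Longrightarrow> g y \<in> C \<and> y \<in> common_multiples V w (g y)"
    using shadow_overlap_selector[OF assms(1)] by metis
  then show ?thesis using assms(2) by (intro card_inj_on_le[of g]) auto
qed

text \<open>
  The shadow of \<open>r\<close> distinct variables, among \<open>n\<close>, has \<open>n + (n - 1) + \<dots> + (n - r + 1)\<close> elements.
  The truncation of the subtraction makes the lower bound below valid for all \<open>r\<close>.
\<close>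
definition star_growth :: "nat \<Rightarrow> nat \<Rightarrow> nat" where
  "star_growth n r = (\<Sum>i<r. n - i)"

lemma star_growth_simps [simp]: "star_growth n 0 = 0" "star_growth n (Suc r) = star_growth n r + (n - r)"
  by (simp_all add: star_growth_def)

lemma star_growth_le_card_shadow_on:
  assumes V: "finite V" and C: "finite C" shows "star_growth (card V) (card C) \<le> card (shadow_on V C)"
  using C
proof induction
  case (insert w C)
  have "card (shadow_on V C) \<le> card (shadow_on V (insert w C))"
    using insert(1) V by (intro card_mono shadow_on_mono finite_shadow_on) auto
  then have "star_growth (card V) (card C) + (card V - card C) \<le> card (shadow_on V (insert w C))"
    using insert.IH card_shadow_on_insert[OF V insert(1), of w] card_shadow_overlap_le[OF insert(2,1), of V]
    by linarith
  then show ?case using insert by simp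
qed simp

text \<open>
  When \<open>x\<^sub>k m\<close> joins, its products with the variables \<open>x\<^sub>j\<close> for which \<open>x\<^sub>j m\<close> is present are not new.
\<close>
lemma card_shadow_on_star_le:
  assumes V: "finite V" and K: "K \<subseteq> V"
  shows "card (shadow_on V ((\<lambda>i. xvar i + m) ` K)) \<le> star_growth (card V) (card K)"
proof -
  have "finite K" using V K finite_subset by blast
  then show ?thesis using K
  proof induction
    case (insert k K)
    let ?S = "\<lambda>K. (\<lambda>i. xvar i + m) ` K"
    let ?T = "(\<lambda>j. xvar j + (xvar k + m)) ` (V - K)"
    have "shadow_on V (?S (insert k K)) \<subseteq> shadow_on V (?S K) \<union> ?T"
    proof
      fix y assume "y \<in> shadow_on V (?S (insert k K))"
      then obtain j i where y: "y = xvar j + (xvar i + m)" "j \<in> V" "i \<in> insert k K"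
        by (auto simp: shadow_on_def)
      show "y \<in> shadow_on V (?S K) \<union> ?T"
      proof (cases "i \<in> K")
        case True
        then show ?thesis using y by (auto intro!: shadow_onI)
      next
        case False
        then have i: "i = k" using y by simp
        show ?thesis
        proof (cases "j \<in> K")
          case True
          then have "xvar k + (xvar j + m) \<in> shadow_on V (?S K)" using insert by (intro shadow_onI) auto
          then show ?thesis using y i by (simp add: add.left_commute)
        qed (use y i in auto)
      qed
    qed
    then have "card (shadow_on V (?S (insert k K))) \<le> card (shadow_on V (?S K) \<union> ?T)"
      using V insert by (intro card_mono) (auto intro!: finite_shadow_on)
    also have "\<dots> \<le> card (shadow_on V (?S K)) + card ?T" by (rule card_Un_le)
    also have "card ?T \<le> card V - card K"
      using card_image_le[of "V - K" "\<lambda>j. xvar j + (xvar k + m)"] V insert by (simp add: card_Diff_subset)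
    finally show ?case using insert by simp
  qed simp
qed

lemma card_star: "card ((\<lambda>i. xvar i + m) ` K) = card K"
proof -
  have "inj_on (\<lambda>i. xvar i + m) K"
    using xvar_add_less_iff by (intro inj_onI) (metis less_irrefl nat_neq_iff)
  then show ?thesis by (simp add: card_image)
qed

text \<open>
  If the bound is attained, every monomial \<open>w\<close> of the set shares a common multiple with each other
  one, and these common multiples are distinct. Removing \<open>w\<close> leaves a set of the same kind, say of
  multiples \<open>x\<^sub>a m\<close>. Write \<open>x\<^sub>i w = x\<^sub>k x\<^sub>a m\<close> and \<open>x\<^sub>i\<^sub>' w = x\<^sub>k\<^sub>' x\<^sub>b m\<close> with \<open>i \<noteq> i'\<close>. If \<open>a \<noteq> i\<close>, then \<open>x\<^sub>i\<close> must
  occur more often in \<open>m\<close> than in \<open>w\<close> by the first equation, but not by the second. So \<open>a = i\<close>, and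
  \<open>w = x\<^sub>k m\<close>.
\<close>
lemma star_of_card_shadow_on_eq:
  assumes V: "finite V" and C: "finite C" "2 \<le> card C" "card C \<le> card V"
    and eq: "card (shadow_on V C) = star_growth (card V) (card C)"
  shows "\<exists>m. \<forall>w\<in>C. \<exists>i. w = xvar i + m"
  using C eq
proof induction
  case (insert w C)
  define Ov where "Ov = shadow_on V {w} \<inter> shadow_on V C"
  have O: "card Ov = card C" and shC: "card (shadow_on V C) = star_growth (card V) (card C)"
    using card_shadow_on_insert[OF V insert(1), of w] card_shadow_overlap_le[OF insert(2,1), of V]
      star_growth_le_card_shadow_on[OF V insert(1)] insert
    unfolding Ov_def by simp_all
  obtain g where g: "inj_on g Ov" "\<And>y. y \<in> Ov \<Longrightarrow> g y \<in> C \<and> y \<in> common_multiples V w (g y)"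
    using shadow_overlap_selector[OF insert(2)] unfolding Ov_def by metis
  have "g ` Ov \<subseteq> C" using g(2) by blast
  then have "g ` Ov = C"
    using card_subset_eq[OF insert(1)] card_image[OF g(1)] O by simp
  then have nb: "\<exists>y. y \<in> Ov \<and> g y = w'" if "w' \<in> C" for w' using that by (metis imageE)
  have neighbour: "\<exists>i k. y = xvar i + w \<and> xvar i + w = xvar k + g y" if "y \<in> Ov" for y
    using g(2)[OF that] by (auto simp: common_multiples_def shadow_on_def)
  show ?case
  proof (cases "card C = 1")
    case True
    then obtain w1 where w1: "C = {w1}" by (auto simp: card_1_singleton_iff)
    then obtain y where y: "y \<in> Ov" "g y = w1" using nb[of w1] by blast
    then obtain i k where ik: "xvar i + w = xvar k + w1" using neighbour by blast
    have "i \<noteq> k" using ik insert w1 by auto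
    then have "0 < expo w k" using arg_cong[OF ik, of "\<lambda>w. expo w k"] by (simp add: lookup_add)
    then obtain m where m: "w = xvar k + m" by (rule mon_factor_xvar)
    then have "w1 = xvar i + m" using ik by (metis add.left_commute add_left_cancel)
    then show ?thesis using m w1 by blast
  next
    case False
    then have "2 \<le> card C" using insert by simp
    then obtain m where m: "\<And>w'. w' \<in> C \<Longrightarrow> \<exists>i. w' = xvar i + m" using insert shC by auto
    obtain w1 w2 where w12: "w1 \<in> C" "w2 \<in> C" "w1 \<noteq> w2"
      using \<open>2 \<le> card C\<close> by (metis card_le_Suc0_iff_eq insert(1) not_less_eq_eq numeral_2_eq_2)
    obtain y1 y2 where y: "y1 \<in> Ov" "g y1 = w1" "y2 \<in> Ov" "g y2 = w2" using nb w12 by metis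
    obtain i k i' k' where ik: "y1 = xvar i + w" "xvar i + w = xvar k + w1"
        "y2 = xvar i' + w" "xvar i' + w = xvar k' + w2"
      using neighbour[OF y(1)] neighbour[OF y(3)] y by blast
    have "i \<noteq> i'" using ik y w12 by auto
    obtain a b where ab: "w1 = xvar a + m" "w2 = xvar b + m" using m w12 by blast
    have "a = i"
    proof (rule ccontr)
      assume "a \<noteq> i"
      have "k \<noteq> i" using ik w12 insert by auto
      then have "1 + expo w i = expo m i"
        using arg_cong[OF ik(2), of "\<lambda>w. expo w i"] \<open>a \<noteq> i\<close> by (simp add: ab lookup_add)
      moreover have "expo m i \<le> expo w i"
        using arg_cong[OF ik(4), of "\<lambda>w. expo w i"] \<open>i \<noteq> i'\<close> by (simp add: ab lookup_add)
      ultimately show False by simp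
    qed
    then have "w = xvar k + m" using ik(2) ab by (simp add: add.left_commute)
    then show ?thesis using m by blast
  qed
qed simp

text \<open>
  The products of a fixed monomial with distinct variables are competitors that meet the lower bound.
\<close>
lemma card_shadow_on_initial_small:
  assumes V: "finite V" and d: "1 \<le> d" and D: "upset_in (mons V d) D" "card D \<le> card V"
  shows "card (shadow_on V D) = star_growth (card V) (card D)"
proof (rule antisym)
  have "finite D" using finite_subset[OF upset_in_subset[OF D(1)] finite_mons[OF V]] .
  then show "star_growth (card V) (card D) \<le> card (shadow_on V D)"
    by (rule star_growth_le_card_shadow_on[OF V])
  obtain K where K: "K \<subseteq> V" "card K = card D" using D(2) by (metis obtain_subset_with_card_n)
  show "card (shadow_on V D) \<le> star_growth (card V) (card D)"
  proof (cases "V = {}")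
    case False
    then obtain p where p: "p \<in> V" by blast
    define m where "m = Poly_Mapping.single p (d - 1)"
    have "m \<in> mons V (d - 1)" using p by (auto simp: m_def mons_def)
    then have "(\<lambda>i. xvar i + m) ` K \<subseteq> mons V d"
      using K d by (auto simp: mon_add_mons_iff)
    then have "card (shadow_on V D) \<le> card (shadow_on V ((\<lambda>i. xvar i + m) ` K))"
      using macaulay[OF V] D K unfolding macaulay_on_def by (simp add: card_star)
    also have "\<dots> \<le> star_growth (card V) (card K)" by (rule card_shadow_on_star_le[OF V K(1)])
    finally show ?thesis using K by simp
  qed (use D in \<open>simp add: shadow_on_def\<close>)
qed

section \<open>Lexsegments in a single power of the first variable\<close>

lemma mons_0: "mons V 0 = {0}"
  by (auto simp: mons_def mon_degree_def in_keys_iff intro: poly_mapping_eqI)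

lemma mons_Suc_factor:
  assumes V: "finite V" and w: "w \<in> mons V (Suc d)"
  obtains i z where "i \<in> V" "z \<in> mons V d" "w = xvar i + z"
proof -
  have "sum (expo w) V \<noteq> 0" using w V by (simp add: mons_iff)
  then obtain i where i: "i \<in> V" "0 < expo w i" by (meson gr_zeroI sum.neutral)
  obtain z where "w = xvar i + z" using i(2) by (rule mon_factor_xvar)
  then show thesis using that i w xvar_mons_iff by blast
qed

lemma mons_le_single_Min:
  assumes U: "finite U" "p \<in> U" "\<And>i. i \<in> U \<Longrightarrow> p \<le> i" and w: "w \<in> mons U d"
  shows "w \<le> Poly_Mapping.single p d"
proof (rule ccontr)
  assume "\<not> ?thesis"
  then obtain k where k: "expo (Poly_Mapping.single p d) k < expo w k"
      "\<And>k'. k' < k \<Longrightarrow> expo (Poly_Mapping.single p d) k' = expo w k'"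
    by (auto simp: not_le mon_less_iff)
  have "k \<in> U" using k(1) w U by (metis mons_iff not_less_zero)
  have "k \<noteq> p" using expo_le_degree[OF U(1) w, of p] k(1) by auto
  then have "p < k" using U(3)[OF \<open>k \<in> U\<close>] by simp
  then have "expo w p = d" using k(2)[of p] by simp
  moreover have "expo w p + expo w k \<le> d"
    using w U \<open>k \<in> U\<close> \<open>k \<noteq> p\<close> sum_mono2[of U "{p,k}" "expo w"] by (simp add: mons_iff)
  ultimately show False using k(1) by simp
qed

lemma single_Max_le_mons:
  assumes U: "finite U" "p \<in> U" "\<And>i. i \<in> U \<Longrightarrow> i \<le> p" and w: "w \<in> mons U d"
  shows "Poly_Mapping.single p d \<le> w"
proof (rule ccontr)
  assume "\<not> ?thesis"
  then obtain k where k: "expo w k < expo (Poly_Mapping.single p d) k"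
      "\<And>k'. k' < k \<Longrightarrow> expo w k' = expo (Poly_Mapping.single p d) k'"
    by (auto simp: not_le mon_less_iff)
  have "k = p" using k(1) by (auto simp: lookup_single when_def split: if_splits)
  then have "expo w i = 0" if "i \<in> U" "i \<noteq> p" for i
    using k(2)[of i] U(3)[OF that(1)] that by (simp add: lookup_single when_def)
  then have "sum (expo w) U = expo w p"
    using U by (simp add: sum.remove)
  then show False using w U k(1) \<open>k = p\<close> by (simp add: mons_iff)
qed

lemma upset_in_star_Min:
  assumes U: "finite U" "p \<in> U" "\<And>i. i \<in> U \<Longrightarrow> p \<le> i"
  shows "upset_in (mons U (Suc d)) ((\<lambda>i. xvar i + Poly_Mapping.single p d) ` U)"
  unfolding upset_in_def
proof (intro conjI ballI impI)
  let ?s = "Poly_Mapping.single p d"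
  have s: "?s \<in> mons U d" using U by (auto simp: mons_def)
  then show "(\<lambda>i. xvar i + ?s) ` U \<subseteq> mons U (Suc d)" by (auto simp: xvar_mons_iff)
  fix w z assume w: "w \<in> (\<lambda>i. xvar i + ?s) ` U" and z: "z \<in> mons U (Suc d)" "w < z"
  have "d \<le> expo z p"
  proof (rule ccontr)
    assume "\<not> ?thesis"
    moreover have "expo w i = 0" "expo z i = 0" if "i < p" for i
    proof -
      have "i \<notin> U" using that U(3) not_le by blast
      then show "expo w i = 0" "expo z i = 0"
        using w z(1) s U by (auto simp: mons_iff lookup_add lookup_single when_def)
    qed
    moreover have "d \<le> expo w p" using w by (auto simp: lookup_add)
    ultimately have "z < w" unfolding mon_less_iff by (intro exI[of _ p]) auto
    then show False using z by simp
  qed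
  then obtain y where y: "z = ?s + y" by (rule mon_factor_single)
  then have "y \<in> mons U (Suc 0)" using z by (auto simp: mon_add_mons_iff)
  then obtain i where "i \<in> U" "y = xvar i"
    using mons_Suc_factor[OF U(1), of y 0] mons_0[of U] by (metis add.right_neutral singletonD)
  then show "z \<in> (\<lambda>i. xvar i + ?s) ` U" unfolding y by (auto simp: add.commute)
qed

lemma card_shadow_on_hyperplane:
  assumes V: "finite V" "j \<in> V" and C: "finite C" "C \<subseteq> mons (V - {j}) d"
  shows "card (shadow_on V C) = card (shadow_on (V - {j}) C) + card C"
proof -
  have z: "expo w j = 0" if "w \<in> C" for w
    using that C V by (auto simp: mons_iff subset_iff)
  then have "{w \<in> C. expo w j = 0} = C" by auto
  moreover have "xvar j + z \<notin> C" for z using z[of "xvar j + z"] by (auto simp: lookup_add)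
  ultimately show ?thesis using card_shadow_on_stable[OF V C(1)] by simp
qed

text \<open>
  By Macaulay's theorem in \<open>V - {j}\<close> the set \<open>L\<close> may be replaced by an initial segment \<open>E\<close>. Having
  more elements than there are variables, \<open>E\<close> without its least element still contains all \<open>x\<^sub>i s\<close> with
  \<open>i \<in> V - {j}\<close>, where \<open>s\<close> is a power of the largest remaining variable. Trading the least element for \<open>x\<^sub>j s\<close>
  introduces one new element of the shadow but removes at least two: the products of the least
  element with \<open>x\<^sub>j\<close> and with the smallest variable.
\<close>
lemma exists_smaller_shadow_of_hyperplane:
  assumes V: "finite V" "j \<in> V" and L: "L \<subseteq> mons (V - {j}) d" and card: "card V < card L"
  obtains C where "C \<subseteq> mons V d" "card C = card L" "card (shadow_on V C) < card (shadow_on V L)"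
proof -
  define U where "U = V - {j}"
  have U: "finite U" "card V = Suc (card U)" unfolding U_def using V card_Suc_Diff1[of V j] by (simp_all del: card_Diff_insert)
  have L: "L \<subseteq> mons U d" using L by (simp add: U_def)
  have finL: "finite L" using L finite_mons[OF U(1)] finite_subset by blast
  have "d \<noteq> 0"
  proof
    assume "d = 0"
    then have "card L \<le> card {0 :: nat \<Rightarrow>\<^sub>0 nat}" using L mons_0 by (intro card_mono) auto
    then show False using card U by simp
  qed
  then obtain d' where d: "d = Suc d'" by (metis not0_implies_Suc)
  have "U \<noteq> {}"
  proof
    assume "U = {}"
    then have "mons U d = {}" using d mons_Suc_factor[of U] by blast
    then show False using L card by simp
  qed
  define p where "p = Min U"
  define M where "M = Max U"
  have p: "p \<in> U" "\<And>i. i \<in> U \<Longrightarrow> p \<le> i" unfolding p_def using U \<open>U \<noteq> {}\<close> by (auto intro: Min_in)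
  have M: "M \<in> U" "\<And>i. i \<in> U \<Longrightarrow> i \<le> M" unfolding M_def using U \<open>U \<noteq> {}\<close> by (auto intro: Max_in)
  define s where "s = Poly_Mapping.single p d'"
  define T where "T = (\<lambda>i. xvar i + s) ` U"
  define E where "E = top_set (mons U d) (card L)"
  define E0 where "E0 = E - {Min E}"
  have E: "upset_in (mons U d) E" "card E = card L"
    unfolding E_def using finite_mons[OF U(1)] L by (simp_all add: upset_in_top_set card_top_set card_mono)
  have finE: "finite E" using finite_subset[OF upset_in_subset[OF E(1)] finite_mons[OF U(1)]] .
  have "E \<noteq> {}" using E(2) card by auto
  then have minE: "Min E \<in> E" "\<And>w. w \<in> E \<Longrightarrow> Min E \<le> w" using finE by (auto intro: Min_in)
  have cardE0: "card E0 = card L - 1" using minE finE E(2) by (simp add: E0_def)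
  have E0: "upset_in (mons U d) E0"
    unfolding upset_in_def
  proof (intro conjI ballI impI)
    show "E0 \<subseteq> mons U d" using upset_in_subset[OF E(1)] by (auto simp: E0_def)
    fix w z assume "w \<in> E0" "z \<in> mons U d" "w < z"
    then have "z \<in> E" "Min E < z"
      using upset_inD[OF E(1), of w z] minE(2)[of w] by (auto simp: E0_def)
    then show "z \<in> E0" by (simp add: E0_def)
  qed
  have finE0: "finite E0" using finE by (simp add: E0_def)
  have T: "T \<subseteq> E0"
  proof (rule upset_in_subset_if_card_le[OF finite_mons[OF U(1)] _ E0])
    show "upset_in (mons U d) T" unfolding T_def s_def d by (rule upset_in_star_Min[OF U(1) p])
    show "card T \<le> card E0" unfolding T_def card_star using cardE0 card U by simp
  qed
  \<comment> \<open>Apart from \<open>x\<^sub>j c\<close>, every multiple \<open>x\<^sub>i c\<close> is \<open>x\<^sub>j\<close> times an element of \<open>T\<close>, so \<open>c\<close> costs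
    a single new monomial.\<close>
  define c where "c = xvar j + s"
  define C where "C = insert c E0"
  have "U \<subseteq> V" "j \<notin> U" by (auto simp: U_def)
  have mUV: "mons U d \<subseteq> mons V d" using \<open>U \<subseteq> V\<close> by (auto simp: mons_def)
  have "c \<notin> E0"
  proof
    assume "c \<in> E0"
    then have "expo c j = 0" using upset_in_subset[OF E0] U \<open>j \<notin> U\<close> by (auto simp: mons_iff)
    then show False by (simp add: c_def lookup_add)
  qed
  then have cardC: "card C = card L" using cardE0 finE0 card by (simp add: C_def)
  have "s \<in> mons V d'" using p \<open>U \<subseteq> V\<close> by (auto simp: s_def mons_def)
  then have CV: "C \<subseteq> mons V d"
    using upset_in_subset[OF E0] mUV V by (auto simp: C_def c_def d xvar_mons_iff)
  have "shadow_on V C \<subseteq> insert (xvar j + c) (shadow_on V E0)"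
  proof
    fix y assume "y \<in> shadow_on V C"
    then obtain i w where y: "y = xvar i + w" "i \<in> V" "w \<in> C" by (rule shadow_onE)
    show "y \<in> insert (xvar j + c) (shadow_on V E0)"
    proof (cases "w \<in> E0 \<or> i = j")
      case True
      then show ?thesis using y by (auto simp: C_def intro: shadow_onI)
    next
      case False
      then have "i \<in> U" "w = c" using y by (auto simp: C_def U_def)
      then have "xvar j + (xvar i + s) \<in> shadow_on V E0" using T V by (intro shadow_onI) (auto simp: T_def)
      then show ?thesis unfolding y \<open>w = c\<close> c_def by (simp add: add.left_commute)
    qed
  qed
  then have "card (shadow_on V C) \<le> card (insert (xvar j + c) (shadow_on V E0))"
    using V finE0 by (intro card_mono) (auto intro: finite_shadow_on)
  also have "\<dots> \<le> Suc (card (shadow_on V E0))" by (rule card_insert_le_m1) simp_all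
  also have "card (shadow_on V E0) = card (shadow_on U E0) + card E0"
    using card_shadow_on_hyperplane[OF V finE0] upset_in_subset[OF E0] by (simp add: U_def)
  finally have *: "card (shadow_on V C) \<le> Suc (card (shadow_on U E0) + (card L - 1))" by (simp add: cardE0)
  have "card (shadow_on U E0) < card (shadow_on U E)"
  proof (rule psubset_card_mono)
    have "xvar M + Min E \<noteq> xvar i + w" if "i \<in> U" "w \<in> E0" for i w
    proof -
      have "Min E < w" using that minE by (auto simp: E0_def order.strict_iff_order)
      then have "xvar M + Min E < xvar M + w" by simp
      also have "\<dots> \<le> xvar i + w" using M(2)[OF that(1)] xvar_add_less_iff[of M w i] by (metis le_less)
      finally show ?thesis by simp
    qed
    then have "xvar M + Min E \<notin> shadow_on U E0" by (auto simp: shadow_on_def)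
    moreover have "xvar M + Min E \<in> shadow_on U E" using M minE by (intro shadow_onI)
    moreover have "shadow_on U E0 \<subseteq> shadow_on U E" by (rule shadow_on_mono) (auto simp: E0_def)
    ultimately show "shadow_on U E0 \<subset> shadow_on U E" by blast
  qed (intro finite_shadow_on U finE)
  also have "\<dots> \<le> card (shadow_on U L)"
    using macaulay[OF U(1)] L E unfolding macaulay_on_def by simp
  finally have "card (shadow_on V C) < card (shadow_on U L) + card L" using * card by simp
  also have "\<dots> = card (shadow_on V L)"
    using card_shadow_on_hyperplane[OF V finL] L by (simp add: U_def)
  finally show thesis using that CV cardC by blast
qed

lemma exists_smaller_shadow_of_slice:
  assumes V: "finite V" "j \<in> V" and L: "L \<subseteq> slice j a (mons V d)" and card: "card V < card L"
  obtains C where "C \<subseteq> mons V d" "card C = card L" "card (shadow_on V C) < card (shadow_on V L)"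
proof -
  obtain w where "w \<in> L" using card by fastforce
  then have ad: "a \<le> d" using L expo_le_degree[OF V(1), of w d j] by (auto simp: slice_def)
  let ?m = "Poly_Mapping.single j a"
  obtain L0 where L0: "L = (+) ?m ` L0" "L0 \<subseteq> mons (V - {j}) (d - a)"
    using L slice_mons[OF V(2) ad] by (metis subset_image_iff)
  obtain C where C: "C \<subseteq> mons V (d - a)" "card C = card L0" "card (shadow_on V C) < card (shadow_on V L0)"
    using exists_smaller_shadow_of_hyperplane[OF V L0(2)] card unfolding L0(1) card_translate by blast
  have "Poly_Mapping.keys ?m \<subseteq> V" using V by auto
  then have "(+) ?m ` C \<subseteq> mons V d" using C(1) ad by (auto simp: mon_add_mons_iff)
  then show thesis
    using that[of "(+) ?m ` C"] C unfolding L0(1) by (simp add: card_translate shadow_on_translate)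
qed

section \<open>Lexsegments in several powers of the first variable\<close>

text \<open>
  Compression in direction \<open>j\<close> turns the lower set \<open>A\<close> in the slice \<open>b + 1\<close> into an initial segment
  and leaves the initial segment \<open>B\<close> in the slice \<open>b\<close> as it is. If it does not shrink the shadow, then
  one of the two sets \<open>shadow_on U A\<close> and \<open>x\<^sub>j B\<close> whose union is the slice \<open>b + 1\<close> of the shadow
  contains the other. The first contains the least and the second the greatest monomial of that
  slice, and this makes the larger of the two the whole slice.
\<close>
lemma two_slices_cover:
  assumes V: "finite V" "j \<in> V" and L: "L \<subseteq> mons V d"
    and A: "slice j (Suc b) L \<noteq> {}"
      "\<And>w z. w \<in> slice j (Suc b) L \<Longrightarrow> z \<in> slice j (Suc b) (mons V d) \<Longrightarrow> z \<le> w \<Longrightarrow> z \<in> L"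
    and B: "slice j b L \<noteq> {}" "upset_in (slice j b (mons V d)) (slice j b L)"
    and le: "card (shadow_on V L) \<le> card (shadow_on V (compress V d j L))"
  shows "slice j (Suc b) (mons V (Suc d)) \<subseteq> shadow_on V L"
proof -
  define U where "U = V - {j}"
  define A where "A = slice j (Suc b) L"
  define K where "K = compress V d j L"
  define P where "P = shadow_on U (slice j (Suc b) K)"
  define Q where "Q = (+) (xvar j) ` slice j b L"
  define X where "X = slice j (Suc b) (mons V (Suc d))"
  have U: "finite U" "U \<subseteq> V" "j \<notin> U" using V by (auto simp: U_def)
  have IH: "macaulay_on (V - {j})" using macaulay V by simp
  have AL: "A \<subseteq> slice j (Suc b) (mons V d)" unfolding A_def by (rule slice_mono[OF L])
  obtain w where w: "w \<in> A" using A unfolding A_def by blast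
  then have bd: "Suc b \<le> d" using AL expo_le_degree[OF V(1), of w d j] by (auto simp: slice_def)
  define e where "e = d - Suc b"
  have d: "d = Suc b + e" using bd by (simp add: e_def)
  define m0 where "m0 = Poly_Mapping.single j b"
  define m1 where "m1 = Poly_Mapping.single j (Suc b)"
  have slA: "slice j (Suc b) (mons V d) = (+) m1 ` mons U e"
    unfolding m1_def U_def d using slice_mons[OF V(2), of "Suc b" "Suc b + e"] by simp
  have slB': "slice j b (mons V d) = (+) m0 ` mons U (Suc e)"
    unfolding m0_def U_def d using slice_mons[OF V(2), of b "Suc b + e"] by simp
  have slX: "X = (+) m1 ` mons U (Suc e)"
    unfolding X_def m1_def U_def d using slice_mons[OF V(2), of "Suc b" "Suc (Suc b + e)"] by simp
  obtain y0 where y0: "y0 \<in> slice j b L" using B(1) by blast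
  then obtain z0 where "z0 \<in> mons U (Suc e)" using slB' upset_in_subset[OF B(2)] by blast
  then have "U \<noteq> {}" using mons_Suc_factor[OF U(1)] by blast
  define p where "p = Min U"
  define M where "M = Max U"
  have p: "p \<in> U" "\<And>i. i \<in> U \<Longrightarrow> p \<le> i" unfolding p_def using U \<open>U \<noteq> {}\<close> by (auto intro: Min_in)
  have M: "M \<in> U" "\<And>i. i \<in> U \<Longrightarrow> i \<le> M" unfolding M_def using U \<open>U \<noteq> {}\<close> by (auto intro: Max_in)
  have slB: "slice j b K = slice j b L"
  proof -
    have "finite (slice j b (mons V d))" using finite_mons[OF V(1)] by (simp add: slice_def)
    then show ?thesis
      using upset_in_subset_if_card_le[OF _ upset_in_slice_compress[OF V L] B(2)]
        upset_in_subset_if_card_le[OF _ B(2) upset_in_slice_compress[OF V L]] card_slice_compress[OF V L]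
      unfolding K_def by (metis order_refl subset_antisym)
  qed
  have shL: "slice j (Suc b) (shadow_on V L) = shadow_on U A \<union> Q"
    unfolding U_def A_def Q_def by (rule slice_shadow_on(2)[OF V(2)])
  have shK: "slice j (Suc b) (shadow_on V K) = P \<union> Q"
    unfolding U_def P_def Q_def slB[symmetric] by (rule slice_shadow_on(2)[OF V(2)])
  have finX: "finite X" using finite_mons[OF V(1)] by (simp add: slice_def X_def)
  have upP: "upset_in X P"
    unfolding X_def P_def U_def K_def
    by (rule upset_in_shadow_slice[OF V IH upset_in_slice_compress[OF V L]])
  have upQ: "upset_in X Q"
    unfolding X_def Q_def slice_mons_Suc[OF V(2)] upset_in_translate by (rule B(2))
  have shA: "shadow_on U A \<subseteq> X"
    using slice_shadow_on(2)[OF V(2), of b L] slice_mono[OF shadow_on_mons[OF L]] unfolding A_def U_def X_def by blast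
  have fin: "finite (shadow_on U A)" "finite P" "finite Q"
    using shA upset_in_subset[OF upP] upset_in_subset[OF upQ] finX finite_subset by blast+
  have "card (slice j (Suc b) (shadow_on V L)) \<le> card (slice j (Suc b) (shadow_on V K))"
    using card_shadow_compress(2)[OF V L IH, of "Suc b"] le unfolding K_def by (meson not_le)
  then have "card (shadow_on U A \<union> Q) \<le> max (card P) (card Q)"
    unfolding shL shK card_Un_upset_in[OF finX upP upQ] .
  then consider "card (shadow_on U A \<union> Q) \<le> card Q" | "card (shadow_on U A \<union> Q) \<le> card P"
    by (auto simp: max_def split: if_splits)
  then have "X \<subseteq> shadow_on U A \<union> Q"
  proof cases
    case 1
    then have sub: "shadow_on U A \<subseteq> Q" using fin by (metis Un_upper1 card_seteq finite_Un sup_ge2)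
    \<comment> \<open>\<open>A\<close> is closed downwards, so \<open>Q\<close> contains the least element of \<open>X\<close>, hence all of \<open>X\<close>.\<close>
    define q where "q = m1 + Poly_Mapping.single M e"
    have "q \<in> slice j (Suc b) (mons V d)" unfolding slA q_def using M by (auto simp: mons_def)
    moreover have "q \<le> w" using w AL single_Max_le_mons[OF U(1) M] unfolding slA q_def by auto
    ultimately have "q \<in> A" using A(2)[of w q] w unfolding A_def by (auto simp: slice_def)
    then have "xvar M + q \<in> Q" using sub M by (auto intro: shadow_onI)
    moreover have "xvar M + q \<le> y" if "y \<in> X" for y
    proof -
      have "xvar M + q = m1 + Poly_Mapping.single M (Suc e)"
        unfolding q_def xvar_def using single_add[of M 1 e] by (simp add: add.left_commute)
      then show ?thesis using that single_Max_le_mons[OF U(1) M] unfolding slX by auto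
    qed
    ultimately have "X \<subseteq> Q" using upset_inD[OF upQ] by blast
    then show ?thesis by blast
  next
    case 2
    also have "card P \<le> card (shadow_on U A)"
      unfolding P_def U_def K_def
      by (rule card_shadow_slice_le[OF V IH upset_in_slice_compress[OF V L] AL[unfolded U_def]])
        (simp add: A_def card_slice_compress[OF V L])
    \<comment> \<open>\<open>B\<close> is closed upwards, so \<open>shadow_on U A\<close> contains the greatest element of \<open>X\<close>, which
      forces the greatest element of degree \<open>d\<close>, hence everything, into \<open>A\<close>.\<close>
    finally have sub: "Q \<subseteq> shadow_on U A" using fin by (metis Un_upper1 card_seteq finite_Un sup_ge2)
    define q where "q = m1 + Poly_Mapping.single p e"
    have "m0 + Poly_Mapping.single p (Suc e) \<in> slice j b (mons V d)"
      unfolding slB' using p by (auto simp: mons_def)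
    moreover have "y0 \<le> m0 + Poly_Mapping.single p (Suc e)"
      using subsetD[OF upset_in_subset[OF B(2)] y0] mons_le_single_Min[OF U(1) p] unfolding slB' by auto
    ultimately have "m0 + Poly_Mapping.single p (Suc e) \<in> slice j b L" using upset_inD[OF B(2) y0] by blast
    then have "xvar j + (m0 + Poly_Mapping.single p (Suc e)) \<in> shadow_on U A" using sub unfolding Q_def by blast
    then obtain i w' where i: "xvar j + (m0 + Poly_Mapping.single p (Suc e)) = xvar i + w'" "i \<in> U" "w' \<in> A"
      by (rule shadow_onE)
    obtain z where z: "w' = m1 + z" using i(3) AL unfolding slA by blast
    have "xvar j + m0 = m1" unfolding m0_def m1_def xvar_def using single_add[of j 1 b] by simp
    then have eq: "Poly_Mapping.single p (Suc e) = xvar i + z"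
      using i(1) z by (metis add.assoc add.left_commute add_left_cancel)
    have "i = p"
      using arg_cong[OF eq, of "\<lambda>w. expo w i"] by (auto simp: lookup_add lookup_single when_def split: if_splits)
    then have "z = Poly_Mapping.single p e"
      using eq single_add[of p 1 e] unfolding xvar_def by simp
    then have "q \<in> A" using i z by (simp add: q_def)
    have "slice j (Suc b) (mons V d) \<subseteq> A"
    proof
      fix y assume y: "y \<in> slice j (Suc b) (mons V d)"
      then have "y \<le> q" using mons_le_single_Min[OF U(1) p] unfolding slA q_def by auto
      then have "y \<in> L" using A(2)[of q y] y \<open>q \<in> A\<close> unfolding A_def by blast
      then show "y \<in> A" using y by (simp add: A_def slice_def)
    qed
    moreover have "y \<in> shadow_on U (slice j (Suc b) (mons V d))" if y: "y \<in> X" for y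
    proof -
      obtain z where z: "y = m1 + z" "z \<in> mons U (Suc e)" using y unfolding slX by blast
      obtain i z' where "i \<in> U" "z' \<in> mons U e" "z = xvar i + z'" using mons_Suc_factor[OF U(1) z(2)] by metis
      then have "y = xvar i + (m1 + z')" "i \<in> U" "m1 + z' \<in> slice j (Suc b) (mons V d)"
        unfolding z slA by (auto simp: add.left_commute)
      then show ?thesis using shadow_onI by metis
    qed
    ultimately show ?thesis using shadow_on_mono by blast
  qed
  then show ?thesis using shL unfolding X_def by (auto simp: slice_def)
qed

lemma mons_less_if_expo_1_less:
  assumes "x \<in> mons {1..n} d" "y \<in> mons {1..n} d'" "expo x 1 < expo y 1" shows "x < y"
  unfolding mon_less_iff using assms by (intro exI[of _ 1]) (auto simp: mons_iff)

lemma expo_1_mono: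
  assumes "x \<in> mons {1..n} d" "y \<in> mons {1..n} d'" "x \<le> y" shows "expo x 1 \<le> expo y 1"
  using mons_less_if_expo_1_less[OF assms(2,1)] assms(3) by (meson leD not_le)

lemma lexseg_mons: "lexseg n d u v \<subseteq> mons {1..n} d"
  by (auto simp: lexseg_def Mon_eq_mons)

text \<open>
  A monomial \<open>w\<close> between \<open>x\<^sub>n v\<close> and \<open>x\<^sub>1 u\<close> must be divided by some variable so as to land between \<open>v\<close>
  and \<open>u\<close>. If the exponent of \<open>x\<^sub>1\<close> in \<open>w\<close> is that of \<open>v\<close>, the smallest variable of \<open>w\<close> works; if it
  exceeds that of \<open>v\<close> by at least two, \<open>x\<^sub>1\<close> works. If it exceeds it by one, any other variable works,
  unless the quotient has the same exponent of \<open>x\<^sub>1\<close> as \<open>u\<close>; that case is the hypothesis \<open>cover\<close>.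
\<close>
lemma shadow_lexseg:
  assumes n: "2 \<le> n" and u: "u \<in> mons {1..n} d" and v: "v \<in> mons {1..n} d"
    and less: "expo v 1 < expo u 1"
    and cover: "expo u 1 = Suc (expo v 1) \<Longrightarrow>
      slice 1 (expo u 1) (mons {1..n} (Suc d)) \<subseteq> shadow_on {1..n} (lexseg n d u v)"
  shows "shadow_on {1..n} (lexseg n d u v) = lexseg n (Suc d) (xvar 1 + u) (xvar n + v)"
proof (intro subset_antisym subsetI)
  let ?V = "{1..n}" and ?L = "lexseg n d u v"
  have xv: "xvar n \<le> xvar i" "xvar i \<le> xvar 1" if "i \<in> ?V" for i
    using that xvar_add_less_iff[of n 0 i] xvar_add_less_iff[of i 0 1] by (auto simp: le_less)
  fix w
  show "w \<in> lexseg n (Suc d) (xvar 1 + u) (xvar n + v)" if w: "w \<in> shadow_on ?V ?L"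
  proof -
    from w obtain i z where z: "w = xvar i + z" "i \<in> ?V" "z \<in> ?L" by (rule shadow_onE)
    have "xvar n + v \<le> w" "w \<le> xvar 1 + u"
      unfolding z(1) using z(3) xv[OF z(2)] by (auto simp: lexseg_def intro!: add_mono)
    moreover have "w \<in> mons ?V (Suc d)" using w shadow_on_mons[OF lexseg_mons] by blast
    ultimately show ?thesis by (simp add: lexseg_def Mon_eq_mons)
  qed
  assume "w \<in> lexseg n (Suc d) (xvar 1 + u) (xvar n + v)"
  then have w: "w \<in> mons ?V (Suc d)" "xvar n + v \<le> w" "w \<le> xvar 1 + u"
    by (simp_all add: lexseg_def Mon_eq_mons)
  have in_shadow: "w \<in> shadow_on ?V ?L" if "w = xvar i + z" "i \<in> ?V" "v \<le> z" "z \<le> u" for i z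
    using that w xvar_mons_iff by (auto simp: lexseg_def Mon_eq_mons intro!: shadow_onI)
  have "xvar n + v \<in> mons ?V (Suc d)" using n v by (simp add: xvar_mons_iff)
  then have "expo v 1 \<le> expo w 1"
    using expo_1_mono w n by (fastforce simp: lookup_add)
  then consider "expo w 1 = expo v 1" | "expo w 1 > Suc (expo v 1)"
    | "expo w 1 = Suc (expo v 1)" "expo u 1 = Suc (expo v 1)"
    | "expo w 1 = Suc (expo v 1)" "expo u 1 > Suc (expo v 1)"
    using less by linarith
  then show "w \<in> shadow_on ?V ?L"
  proof cases
    case 1
    have nV: "n \<in> ?V" "\<And>i. i \<in> ?V \<Longrightarrow> i \<le> n" using n by simp_all
    obtain k z where z: "k \<in> ?V" "w = xvar k + z" "z \<in> mons ?V d" "v \<le> z"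
      by (rule factor_above[OF finite_atLeastAtMost nV v w(1,2)])
    have "expo z 1 < expo u 1" using 1 z(2) less by (simp add: lookup_add)
    then have "z < u" using mons_less_if_expo_1_less z(3) u by blast
    then show ?thesis using in_shadow z by simp
  next
    case 2
    then obtain z where z: "w = xvar 1 + z" using mon_factor_xvar[of w 1] by auto
    have "z \<in> mons ?V d" using w(1) z xvar_mons_iff by blast
    moreover have "expo v 1 < expo z 1" using 2 z by (simp add: lookup_add)
    ultimately have "v < z" using mons_less_if_expo_1_less v by blast
    moreover have "z \<le> u" using w(3) z by simp
    ultimately show ?thesis using in_shadow[OF z] n by simp
  next
    case 3
    then have "w \<in> slice 1 (expo u 1) (mons ?V (Suc d))" using w(1) by (simp add: slice_def)
    then show ?thesis using cover 3 by blast
  next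
    case 4
    have "\<exists>i\<in>?V - {1}. expo w i \<noteq> 0"
    proof (rule ccontr)
      assume "\<not> ?thesis"
      then have "sum (expo w) ?V = expo w 1" using n by (simp add: sum.remove[of _ 1])
      moreover have "expo u 1 \<le> d" using expo_le_degree u by blast
      ultimately show False using w(1) 4 by (simp add: mons_iff)
    qed
    then obtain i where "i \<in> ?V - {1}" "expo w i \<noteq> 0" by blast
    then have i: "i \<in> ?V" "i \<noteq> 1" "0 < expo w i" by simp_all
    obtain z where z: "w = xvar i + z" using i(3) by (rule mon_factor_xvar)
    have zm: "z \<in> mons ?V d" using w(1) z xvar_mons_iff by blast
    have "expo z 1 = Suc (expo v 1)" using 4 z i by (simp add: lookup_add)
    then have "v < z" "z < u" using mons_less_if_expo_1_less[OF v zm] mons_less_if_expo_1_less[OF zm u] 4 by simp_all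
    then show ?thesis using in_shadow[OF z i(1)] by simp
  qed
qed

text \<open>
  After one step the exponents of \<open>x\<^sub>1\<close> at the two ends differ by at least two, so the hypothesis
  \<open>cover\<close> is only needed for the first shadow.
\<close>
lemma completely_lexsegment_set_if_cover:
  assumes n: "2 \<le> n" and u: "u \<in> mons {1..n} d" and v: "v \<in> mons {1..n} d"
    and less: "expo v 1 < expo u 1"
    and cover: "expo u 1 = Suc (expo v 1) \<Longrightarrow>
      slice 1 (expo u 1) (mons {1..n} (Suc d)) \<subseteq> shadow_on {1..n} (lexseg n d u v)"
  shows "completely_lexsegment_set n d (lexseg n d u v)"
proof -
  define L where "L = lexseg n d u v"
  have "\<exists>u'\<in>mons {1..n} (d + i). \<exists>v'\<in>mons {1..n} (d + i). expo v' 1 < expo u' 1 \<and>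
     (i = 0 \<and> u' = u \<and> v' = v \<or> Suc (expo v' 1) < expo u' 1) \<and>
     (shadow n ^^ i) L = lexseg n (d + i) u' v'" for i
  proof (induction i)
    case 0
    then show ?case using u v less by (auto simp: L_def)
  next
    case (Suc i)
    then obtain u' v' where u': "u' \<in> mons {1..n} (d + i)" and v': "v' \<in> mons {1..n} (d + i)"
      and less': "expo v' 1 < expo u' 1"
      and alt: "i = 0 \<and> u' = u \<and> v' = v \<or> Suc (expo v' 1) < expo u' 1"
      and eq: "(shadow n ^^ i) L = lexseg n (d + i) u' v'" by blast
    have "(shadow n ^^ Suc i) L = shadow_on {1..n} (lexseg n (d + i) u' v')"
      by (simp add: eq shadow_eq_shadow_on)
    also have "\<dots> = lexseg n (Suc (d + i)) (xvar 1 + u') (xvar n + v')"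
      using shadow_lexseg[OF n u' v' less'] alt cover by auto
    finally have "(shadow n ^^ Suc i) L = lexseg n (d + Suc i) (xvar 1 + u') (xvar n + v')" by simp
    moreover have "xvar 1 + u' \<in> mons {1..n} (d + Suc i)" "xvar n + v' \<in> mons {1..n} (d + Suc i)"
      using n u' v' by (simp_all add: xvar_mons_iff)
    moreover have "Suc (expo (xvar n + v') 1) < expo (xvar 1 + u') 1"
      using less' n by (simp add: lookup_add)
    ultimately show ?case by (metis Suc_lessD)
  qed
  then have "lexsegment_set n (d + i) ((shadow n ^^ i) L)" for i
    unfolding lexsegment_set_def Mon_eq_mons by (metis less_imp_le mons_less_if_expo_1_less)
  from this this[of 0] show ?thesis unfolding completely_lexsegment_set_def L_def by simp
qed

text \<open>
  If \<open>u\<close> and \<open>v\<close> have the same exponent of \<open>x\<^sub>1\<close>, the lexsegment lies in one slice; minimality limits it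
  to at most \<open>n\<close> elements, and then the bound for small sets is attained. If the exponents differ,
  minimality makes it a completely lexsegment set.
\<close>
theorem lexseg_minimal_growth_imp_star:
  assumes u: "u \<in> Mon n d" and v: "v \<in> Mon n d" and vu: "v < u"
    and ncl: "\<not> completely_lexsegment_set n d (lexseg n d u v)"
    and minimal: "card (shadow n (lexseg n d u v)) \<le> card (shadow n (initial_lexseg n d (card (lexseg n d u v))))"
  shows "\<exists>m. \<forall>w\<in>lexseg n d u v. \<exists>i. w = xvar i + m"
proof -
  define V where "V = {1..n}"
  define L where "L = lexseg n d u v"
  define D where "D = top_set (mons V d) (card L)"
  have V: "finite V" "card V = n" by (simp_all add: V_def)
  have uV: "u \<in> mons V d" and vV: "v \<in> mons V d" using u v by (simp_all add: V_def Mon_eq_mons)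
  have LV: "L \<subseteq> mons V d" unfolding L_def V_def by (rule lexseg_mons)
  have finL: "finite L" using LV finite_mons[OF V(1)] finite_subset by blast
  have uL: "u \<in> L" "v \<in> L" using u v vu by (auto simp: L_def lexseg_def)
  have D: "upset_in (mons V d) D" "card D = card L"
    unfolding D_def using finite_mons[OF V(1)] LV by (simp_all add: upset_in_top_set card_top_set card_mono)
  have "initial_lexseg n d (card L) = D"
    by (simp add: initial_lexseg_def top_set_def D_def V_def Mon_eq_mons)
  then have min: "card (shadow_on V L) \<le> card (shadow_on V D)"
    using minimal by (simp add: L_def V_def shadow_eq_shadow_on)
  have least: "card (shadow_on V L) \<le> card (shadow_on V C)" if "C \<subseteq> mons V d" "card C = card L" for C
    using macaulay[OF V(1)] that D min unfolding macaulay_on_def by (metis order_refl order_trans)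
  have d: "1 \<le> d"
  proof (rule ccontr)
    assume "\<not> 1 \<le> d"
    then have "d = 0" by simp
    then show False using uV vV vu mons_0[of V] by simp
  qed
  have n: "2 \<le> n"
  proof (rule ccontr)
    assume "\<not> 2 \<le> n"
    then have "n = 0 \<or> n = 1" by auto
    then have "mons V d \<subseteq> {Poly_Mapping.single 1 d}"
    proof
      assume "n = 0"
      then show ?thesis using d by (auto simp: V_def mons_iff)
    next
      assume "n = 1"
      then show ?thesis
        by (auto simp: V_def mons_iff lookup_single when_def intro!: poly_mapping_eqI)
    qed
    then show False using uV vV vu by auto
  qed
  have j: "1 \<in> V" using n by (simp add: V_def)
  have expo_le: "expo x 1 \<le> expo y 1" if "x \<in> mons V d" "y \<in> mons V d" "x \<le> y" for x y
    using that expo_1_mono unfolding V_def by blast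
  show ?thesis
  proof (cases "expo u 1 = expo v 1")
    case True
    have sl: "L \<subseteq> slice 1 (expo u 1) (mons V d)"
    proof
      fix w assume "w \<in> L"
      then have w: "w \<in> mons V d" "v \<le> w" "w \<le> u" using LV by (auto simp: L_def lexseg_def)
      have "expo w 1 = expo u 1"
        using expo_le[OF vV w(1,2)] expo_le[OF w(1) uV w(3)] True by simp
      then show "w \<in> slice 1 (expo u 1) (mons V d)" using w by (simp add: slice_def)
    qed
    have le: "card L \<le> card V"
    proof (rule ccontr)
      assume "\<not> card L \<le> card V"
      then have "card V < card L" by simp
      then obtain C where "C \<subseteq> mons V d" "card C = card L" "card (shadow_on V C) < card (shadow_on V L)"
        by (rule exists_smaller_shadow_of_slice[OF V(1) j sl])
      then show False using least by (meson leD)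
    qed
    have eq: "card (shadow_on V L) = star_growth (card V) (card L)"
      using min le card_shadow_on_initial_small[OF V(1) d D(1)] D(2)
        star_growth_le_card_shadow_on[OF V(1) finL] by simp
    have ge: "2 \<le> card L"
    proof -
      have "card {u, v} \<le> card L" using uL finL by (intro card_mono) auto
      then show ?thesis using vu by simp
    qed
    show ?thesis using star_of_card_shadow_on_eq[OF V(1) finL ge le eq] unfolding L_def .
  next
    case False
    then have less: "expo v 1 < expo u 1" using expo_le[OF vV uV] vu by (simp add: le_less)
    have "slice 1 (expo u 1) (mons V (Suc d)) \<subseteq> shadow_on V L" if step: "expo u 1 = Suc (expo v 1)"
    proof -
      have "slice 1 (Suc (expo v 1)) (mons V (Suc d)) \<subseteq> shadow_on V L"
      proof (rule two_slices_cover[OF V(1) j LV])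
        show "slice 1 (Suc (expo v 1)) L \<noteq> {}" "slice 1 (expo v 1) L \<noteq> {}"
          using uL step by (auto simp: slice_def)
        show "card (shadow_on V L) \<le> card (shadow_on V (compress V d 1 L))"
          by (intro least compress_mons card_compress V(1) j LV)
        fix w z assume w: "w \<in> slice 1 (Suc (expo v 1)) L"
          and z: "z \<in> slice 1 (Suc (expo v 1)) (mons V d)" and "z \<le> w"
        have "z \<in> mons V d" "expo v 1 < expo z 1" using z by (simp_all add: slice_def)
        then have "v < z" using mons_less_if_expo_1_less[of v n d z d] vV by (simp add: V_def)
        moreover have "z \<le> u" using w \<open>z \<le> w\<close> by (auto simp: slice_def L_def lexseg_def)
        ultimately show "z \<in> L" using \<open>z \<in> mons V d\<close> by (simp add: L_def lexseg_def Mon_eq_mons V_def)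
      next
        show "upset_in (slice 1 (expo v 1) (mons V d)) (slice 1 (expo v 1) L)"
          unfolding upset_in_def
        proof (intro conjI ballI impI)
          show "slice 1 (expo v 1) L \<subseteq> slice 1 (expo v 1) (mons V d)" by (rule slice_mono[OF LV])
          fix w z assume w: "w \<in> slice 1 (expo v 1) L" and z: "z \<in> slice 1 (expo v 1) (mons V d)" "w < z"
          have "z < u" using mons_less_if_expo_1_less[of z n d u d] z uV less by (simp add: V_def slice_def)
          moreover have "v \<le> z" using w z by (auto simp: slice_def L_def lexseg_def)
          ultimately show "z \<in> slice 1 (expo v 1) L"
            using z by (simp add: slice_def L_def lexseg_def Mon_eq_mons V_def)
        qed
      qed
      then show ?thesis using step by simp
    qed
    then have "completely_lexsegment_set n d (lexseg n d u v)"
      using completely_lexsegment_set_if_cover[OF n _ _ less] uV vV unfolding V_def L_def by blast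
    then show ?thesis using ncl by blast
  qed
qed

lemma lexseg_star_consecutive:
  assumes u: "u \<in> Mon n d" and v: "v \<in> Mon n d" and vu: "v < u"
    and keys: "Poly_Mapping.keys u \<subseteq> {t..n}" "Poly_Mapping.keys v \<subseteq> {t..n}" and t: "1 \<le> t"
    and star: "\<forall>w\<in>lexseg n d u v. \<exists>i. w = xvar i + m"
  shows "\<exists>l p. t \<le> l \<and> 1 \<le> p \<and> l + p \<le> n \<and> lexseg n d u v = (\<lambda>i. xvar i + m) ` {l..l + p}"
proof -
  have uL: "u \<in> lexseg n d u v" "v \<in> lexseg n d u v" using u v vu by (auto simp: lexseg_def)
  then obtain l q where l: "u = xvar l + m" and q: "v = xvar q + m" using star by metis
  have "l < q" using vu xvar_add_less_iff unfolding l q by blast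
  have "t \<le> l" "q \<le> n" using keys unfolding l q by (auto simp: keys_mon_add)
  have "xvar i + m \<in> lexseg n d u v" if "i \<in> {l..q}" for i
  proof -
    have "xvar i + m \<in> Mon n d"
      using u that \<open>t \<le> l\<close> \<open>q \<le> n\<close> t unfolding l Mon_eq_mons by (auto simp: mon_add_mons_iff)
    moreover have "v \<le> xvar i + m" "xvar i + m \<le> u"
      unfolding l q using that xvar_add_less_iff[of q m i] xvar_add_less_iff[of i m l] by (auto simp: le_less)
    ultimately show ?thesis by (simp add: lexseg_def)
  qed
  moreover have "w \<in> (\<lambda>i. xvar i + m) ` {l..q}" if w: "w \<in> lexseg n d u v" for w
  proof -
    obtain i where i: "w = xvar i + m" using star w by blast
    have "\<not> w < v" "\<not> u < w" using w by (auto simp: lexseg_def)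
    then have "i \<in> {l..q}" unfolding i l q xvar_add_less_iff by simp
    then show ?thesis using i by blast
  qed
  ultimately have "lexseg n d u v = (\<lambda>i. xvar i + m) ` {l..q}" by blast
  then show ?thesis using \<open>l < q\<close> \<open>t \<le> l\<close> \<open>q \<le> n\<close>
    by (intro exI[of _ l] exI[of _ "q - l"]) auto
qed

section \<open>Ideals of the polynomial ring and monomial ideals\<close>

lemma poly_ring_simps [simp]:
  "carrier (poly_ring n) = {p. \<forall>w\<in>Poly_Mapping.keys p. Poly_Mapping.keys w \<subseteq> {1..n}}"
  "mult (poly_ring n) = (*)" "one (poly_ring n) = 1" "zero (poly_ring n) = 0" "add (poly_ring n) = (+)"
  by (simp_all add: poly_ring_def)

lemma ring_poly_ring: "ring (poly_ring n :: 'k::field mpoly ring)"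
  using poly_ring_cring cring.axioms(1) by blast

lemma scale_eq_single_mult: "scale c p = Poly_Mapping.single 0 c * p"
  unfolding scale_def by (rule mult_map_scale_conv_mult)

lemma mpoly_eq_sum: "(p :: 'k::field mpoly) = (\<Sum>w\<in>Poly_Mapping.keys p. Poly_Mapping.single w (Poly_Mapping.lookup p w))"
proof (rule poly_mapping_eqI)
  fix z
  show "Poly_Mapping.lookup p z = Poly_Mapping.lookup (\<Sum>w\<in>Poly_Mapping.keys p. Poly_Mapping.single w (Poly_Mapping.lookup p w)) z"
    by (cases "z \<in> Poly_Mapping.keys p") (simp_all add: lookup_sum lookup_single when_def in_keys_iff sum.delta)
qed

lemma single_eq_scale_mon_poly: "Poly_Mapping.single w c = scale c (mon_poly w)"
  by (simp add: scale_eq_single_mult mon_poly_def mult_single)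

lemma keys_mon_poly [simp]: "Poly_Mapping.keys (mon_poly w :: 'k::field mpoly) = {w}"
  by (simp add: mon_poly_def)

lemma mon_poly_add: "mon_poly (w + z) = (mon_poly w * mon_poly z :: 'k::field mpoly)"
  by (simp add: mon_poly_def mult_single)

lemma mon_poly_inject: "mon_poly w = (mon_poly z :: 'k::field mpoly) \<longleftrightarrow> w = z"
  by (metis keys_mon_poly singleton_inject)

lemma mon_poly_image_carrier:
  assumes "\<And>w. w \<in> L \<Longrightarrow> Poly_Mapping.keys w \<subseteq> {1..n}"
  shows "mon_poly ` L \<subseteq> carrier (poly_ring n :: 'k::field mpoly ring)"
proof (rule image_subsetI)
  fix w assume "w \<in> L"
  then show "mon_poly w \<in> carrier (poly_ring n :: 'k mpoly ring)"
    using assms[of w] by (simp del: atLeastAtMost_iff)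
qed

lemma card_mon_poly_image: "card (mon_poly ` X :: 'k::field mpoly set) = card X"
  by (rule card_image) (simp add: inj_on_def mon_poly_inject)

lemma keys_single_mult: "Poly_Mapping.keys (Poly_Mapping.single z c * p) \<subseteq> (+) z ` Poly_Mapping.keys (p :: 'k::field mpoly)"
  using keys_mult[of "Poly_Mapping.single z c" p] by (auto split: if_splits)

text \<open>
  Closure under multiplication only has to be checked for terms \<open>c z\<close>, which are the additive
  generators of the ring.
\<close>
lemma ideal_poly_ringI:
  fixes W :: "'k::field mpoly set"
  assumes W: "W \<subseteq> carrier (poly_ring n)" and zero: "0 \<in> W"
    and add: "\<And>p q. p \<in> W \<Longrightarrow> q \<in> W \<Longrightarrow> p + q \<in> W"
    and mult: "\<And>z c p. Poly_Mapping.keys z \<subseteq> {1..n} \<Longrightarrow> p \<in> W \<Longrightarrow> Poly_Mapping.single z c * p \<in> W"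
  shows "ideal W (poly_ring n)"
proof (rule idealI[OF ring_poly_ring])
  interpret ring "poly_ring n :: 'k mpoly ring" by (rule ring_poly_ring)
  have neg: "- p \<in> W" if "p \<in> W" for p
  proof -
    have "Poly_Mapping.single 0 (- 1) = (- 1 :: 'k mpoly)"
      by (metis single_one single_uminus)
    then show ?thesis using mult[of 0 p "- 1"] that by simp
  qed
  show "subgroup W (add_monoid (poly_ring n))"
  proof
    fix x assume x: "x \<in> W"
    then have "\<ominus>\<^bsub>poly_ring n\<^esub> x = - x"
      using minus_equality[of "- x" x] neg W by auto
    then show "inv\<^bsub>add_monoid (poly_ring n)\<^esub> x \<in> W" using neg x by (simp add: a_inv_def)
  qed (use W zero add in auto)
  have l: "q * p \<in> W" if p: "p \<in> W" and q: "q \<in> carrier (poly_ring n)" for p q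
  proof -
    have "(\<Sum>w\<in>S. Poly_Mapping.single w (Poly_Mapping.lookup q w) * p) \<in> W"
      if "finite S" "S \<subseteq> Poly_Mapping.keys q" for S
      using that
    proof induction
      case (insert w S)
      then show ?case using q p mult add by auto
    qed (simp add: zero)
    from this[of "Poly_Mapping.keys q"] have "(\<Sum>w\<in>Poly_Mapping.keys q. Poly_Mapping.single w (Poly_Mapping.lookup q w)) * p \<in> W"
      by (simp add: sum_distrib_right)
    then show ?thesis using mpoly_eq_sum[of q] by simp
  qed
  show "x \<otimes>\<^bsub>poly_ring n\<^esub> a \<in> W" "a \<otimes>\<^bsub>poly_ring n\<^esub> x \<in> W"
    if "a \<in> W" "x \<in> carrier (poly_ring n)" for a x
    using l that by (simp_all add: mult.commute)
qed

lemma mon_combination_in_ideal: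
  fixes I :: "'k::field mpoly set"
  assumes I: "ideal I (poly_ring n)" and X: "mon_poly ` X \<subseteq> I" and p: "Poly_Mapping.keys p \<subseteq> X"
  shows "p \<in> I"
proof -
  interpret ideal I "poly_ring n" by (rule I)
  have "Poly_Mapping.single w c \<in> I" if "w \<in> X" for w c
    using I_l_closed[of "mon_poly w" "Poly_Mapping.single 0 c"] X that
    by (auto simp: mon_poly_def mult_single)
  then have single: "Poly_Mapping.single w c \<in> I" if "w \<in> X" for w c using that by blast
  have "(\<Sum>w\<in>S. Poly_Mapping.single w (Poly_Mapping.lookup p w)) \<in> I"
    if "finite S" "S \<subseteq> X" for S
    using that
  proof induction
    case (insert w S)
    then show ?case
      using additive_subgroup.a_closed[OF ideal.axioms(1)[OF I]] single by simp
  qed (use additive_subgroup.zero_closed[OF ideal.axioms(1)[OF I]] in simp)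
  then have "(\<Sum>w\<in>Poly_Mapping.keys p. Poly_Mapping.single w (Poly_Mapping.lookup p w)) \<in> I" using p by simp
  then show ?thesis using mpoly_eq_sum[of p] by simp
qed

definition multiples :: "nat \<Rightarrow> (nat \<Rightarrow>\<^sub>0 nat) set \<Rightarrow> (nat \<Rightarrow>\<^sub>0 nat) set" where
  "multiples n L = {l + z | l z. l \<in> L \<and> Poly_Mapping.keys z \<subseteq> {1..n}}"

lemma self_multiples: "L \<subseteq> multiples n L"
proof
  fix w assume "w \<in> L"
  then show "w \<in> multiples n L"
    unfolding multiples_def by (intro CollectI exI[of _ w] exI[of _ 0]) simp
qed

lemma multiples_add: "w \<in> multiples n L \<Longrightarrow> Poly_Mapping.keys z \<subseteq> {1..n} \<Longrightarrow> z + w \<in> multiples n L"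
  unfolding multiples_def
  by (auto simp: add.left_commute) (metis Un_least keys_mon_add)

lemma monomial_ideal_eq:
  assumes L: "\<And>w. w \<in> L \<Longrightarrow> Poly_Mapping.keys w \<subseteq> {1..n}"
  shows "monomial_ideal n L = {p :: 'k::field mpoly. Poly_Mapping.keys p \<subseteq> multiples n L}"
proof -
  interpret ring "poly_ring n :: 'k mpoly ring" by (rule ring_poly_ring)
  let ?W = "{p :: 'k mpoly. Poly_Mapping.keys p \<subseteq> multiples n L}"
  have car: "mon_poly ` L \<subseteq> carrier (poly_ring n :: 'k mpoly ring)"
    using L by (rule mon_poly_image_carrier)
  have id: "ideal (monomial_ideal n L :: 'k mpoly set) (poly_ring n)"
    unfolding monomial_ideal_def by (rule genideal_ideal[OF car])
  have self: "mon_poly ` L \<subseteq> (monomial_ideal n L :: 'k mpoly set)"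
    unfolding monomial_ideal_def by (rule genideal_self[OF car])
  have "ideal ?W (poly_ring n)"
  proof (rule ideal_poly_ringI)
    show "?W \<subseteq> carrier (poly_ring n)"
      using L by (fastforce simp: multiples_def keys_mon_add)
    show "p + q \<in> ?W" if "p \<in> ?W" "q \<in> ?W" for p q
      using that keys_add[of p q] by blast
    show "Poly_Mapping.single z c * p \<in> ?W" if "Poly_Mapping.keys z \<subseteq> {1..n}" "p \<in> ?W" for z c p
      using that keys_single_mult[of z c p] multiples_add by blast
  qed simp
  then have "monomial_ideal n L \<subseteq> ?W"
    unfolding monomial_ideal_def using self_multiples[of L n] by (intro genideal_minimal) auto
  moreover have "mon_poly w \<in> (monomial_ideal n L :: 'k mpoly set)" if "w \<in> multiples n L" for w
  proof -
    obtain l z where w: "w = z + l" "l \<in> L" "Poly_Mapping.keys z \<subseteq> {1..n}"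
      using \<open>w \<in> multiples n L\<close> unfolding multiples_def by (auto simp: add.commute)
    then show ?thesis
      using ideal.I_l_closed[OF id, of "mon_poly l" "mon_poly z"] self by (auto simp: mon_poly_add)
  qed
  then have "?W \<subseteq> monomial_ideal n L" using mon_combination_in_ideal[OF id, of "multiples n L"] by blast
  ultimately show ?thesis by blast
qed

lemma Mon_keys: "w \<in> Mon n d \<Longrightarrow> Poly_Mapping.keys w \<subseteq> {1..n}"
  by (simp add: Mon_def)

lemma mon_poly_in_monomial_ideal_iff:
  assumes "\<And>w. w \<in> L \<Longrightarrow> Poly_Mapping.keys w \<subseteq> {1..n}"
  shows "mon_poly w \<in> (monomial_ideal n L :: 'k::field mpoly set) \<longleftrightarrow> w \<in> multiples n L"
  using monomial_ideal_eq[OF assms, where ?'k = 'k] by simp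

lemma multiples_of_degree:
  assumes "L \<subseteq> Mon n d" "w \<in> multiples n L"
  shows "d \<le> mon_degree w" and "mon_degree w = d \<Longrightarrow> w \<in> L"
proof -
  obtain l z where w: "w = l + z" "l \<in> L" using assms unfolding multiples_def by blast
  have "mon_degree l = d" using w assms by (auto simp: Mon_def)
  then show "d \<le> mon_degree w" using w by (simp add: mon_degree_add)
  have "mon_degree z = 0 \<Longrightarrow> z = 0"
    by (auto simp: mon_degree_def in_keys_iff intro: poly_mapping_eqI)
  then show "mon_degree w = d \<Longrightarrow> w \<in> L" using w \<open>mon_degree l = d\<close> by (auto simp: mon_degree_add)
qed

text \<open>
  The generators are the monomials of least degree in the ideal.
\<close>
lemma monomial_ideal_inject:
  assumes L: "L \<subseteq> Mon n d" and L': "L' \<subseteq> Mon n d'"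
    and eq: "monomial_ideal n L = (monomial_ideal n L' :: 'k::field mpoly set)"
  shows "L = L'"
proof -
  have *: "A \<subseteq> B" if A: "A \<subseteq> Mon n e" and B: "B \<subseteq> Mon n e'"
    and eq: "monomial_ideal n A = (monomial_ideal n B :: 'k mpoly set)" for A B e e'
  proof
    fix w assume w: "w \<in> A"
    have mem: "w \<in> multiples n A \<longleftrightarrow> w \<in> multiples n B" for w
      using mon_poly_in_monomial_ideal_iff[of A n w, where ?'k = 'k] mon_poly_in_monomial_ideal_iff[of B n w, where ?'k = 'k]
        A B Mon_keys eq by blast
    then have wB: "w \<in> multiples n B" using w self_multiples by blast
    then obtain b where b: "b \<in> B" unfolding multiples_def by blast
    then have "b \<in> multiples n A" using mem self_multiples by blast
    then have "e \<le> mon_degree b" using multiples_of_degree(1)[OF A] by blast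
    moreover have "mon_degree b = e'" "mon_degree w = e" using b w A B by (auto simp: Mon_def)
    ultimately have "mon_degree w = e'" using multiples_of_degree(1)[OF B wB] by simp
    then show "w \<in> B" using multiples_of_degree(2)[OF B wB] by blast
  qed
  show ?thesis using *[OF L L' eq] *[OF L' L eq[symmetric]] by blast
qed

section \<open>Dimensions, numbers of generators and the Gotzmann property\<close>

lemma span_mon_poly: "mpoly.span (mon_poly ` X) = {p :: 'k::field mpoly. Poly_Mapping.keys p \<subseteq> X}"
proof (intro subset_antisym)
  have "Poly_Mapping.keys (scale c p) \<subseteq> X" if "Poly_Mapping.keys p \<subseteq> X" for c and p :: "'k mpoly"
    using that keys_single_mult[of 0 c p] unfolding scale_eq_single_mult by auto
  moreover have "Poly_Mapping.keys (p + q) \<subseteq> X" if "Poly_Mapping.keys p \<subseteq> X" "Poly_Mapping.keys q \<subseteq> X" for p q :: "'k mpoly"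
    using that keys_add[of p q] by blast
  ultimately have "mpoly.subspace {p :: 'k mpoly. Poly_Mapping.keys p \<subseteq> X}"
    by (intro mpoly.subspaceI) auto
  then show "mpoly.span (mon_poly ` X) \<subseteq> {p :: 'k mpoly. Poly_Mapping.keys p \<subseteq> X}"
    by (intro mpoly.span_minimal) auto
  show "{p :: 'k mpoly. Poly_Mapping.keys p \<subseteq> X} \<subseteq> mpoly.span (mon_poly ` X)"
  proof
    fix p :: "'k mpoly" assume "p \<in> {p. Poly_Mapping.keys p \<subseteq> X}"
    then have "(\<Sum>w\<in>Poly_Mapping.keys p. scale (Poly_Mapping.lookup p w) (mon_poly w)) \<in> mpoly.span (mon_poly ` X)"
      by (intro mpoly.span_sum mpoly.span_scale mpoly.span_base) auto
    then show "p \<in> mpoly.span (mon_poly ` X)"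
      using mpoly_eq_sum[of p] unfolding single_eq_scale_mon_poly by simp
  qed
qed

lemma dim_span_mon_poly: "mpoly.dim (mpoly.span (mon_poly ` X :: 'k::field mpoly set)) = card X"
proof -
  have "mon_poly w \<notin> mpoly.span (mon_poly ` X - {mon_poly w} :: 'k mpoly set)" for w
  proof -
    have "mon_poly ` X - {mon_poly w} = (mon_poly ` (X - {w}) :: 'k mpoly set)"
      by (auto simp: mon_poly_inject)
    then show ?thesis by (simp add: span_mon_poly)
  qed
  then have "mpoly.independent (mon_poly ` X :: 'k mpoly set)"
    unfolding mpoly.dependent_def by blast
  then show ?thesis
    by (metis card_mon_poly_image mpoly.dim_span_eq_card_independent)
qed

lemma graded_component_monomial_ideal:
  assumes L: "L \<subseteq> Mon n d"
  shows "graded_component (monomial_ideal n L) d = mpoly.span (mon_poly ` L :: 'k::field mpoly set)"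
proof -
  have "monomial_ideal n L = {p :: 'k mpoly. Poly_Mapping.keys p \<subseteq> multiples n L}"
    using L Mon_keys by (intro monomial_ideal_eq) blast
  then show ?thesis
    unfolding graded_component_def span_mon_poly
    using multiples_of_degree(2)[OF L] self_multiples[of L n] L by (fastforce simp: Mon_def)
qed

lemma hilbert_function_monomial_ideal:
  assumes L: "L \<subseteq> Mon n d"
  shows "hilbert_function (monomial_ideal n L :: 'k::field mpoly set) d = card L"
  unfolding hilbert_function_def graded_component_monomial_ideal[OF L] by (rule dim_span_mon_poly)

lemma component_ideal_lex_ideal:
  "component_ideal n (lex_ideal n I) d =
    (monomial_ideal n (initial_lexseg n d (hilbert_function I d)) :: 'k::field mpoly set)"
proof -
  interpret ring "poly_ring n :: 'k mpoly ring" by (rule ring_poly_ring)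
  define X where "X = initial_lexseg n d (hilbert_function I d)"
  have X: "X \<subseteq> Mon n d" by (auto simp: X_def initial_lexseg_def)
  have "graded_component (lex_ideal n I) d = {p. Poly_Mapping.keys p \<subseteq> X}"
    unfolding graded_component_def lex_ideal_def image_UN[symmetric] span_mon_poly X_def
    by (fastforce simp: initial_lexseg_def Mon_def)
  then have comp: "component_ideal n (lex_ideal n I) d = Idl\<^bsub>poly_ring n\<^esub> {p. Poly_Mapping.keys p \<subseteq> X}"
    by (simp add: component_ideal_def)
  have car: "mon_poly ` X \<subseteq> carrier (poly_ring n :: 'k mpoly ring)"
    using X Mon_keys by (intro mon_poly_image_carrier) blast
  have car': "{p. Poly_Mapping.keys p \<subseteq> X} \<subseteq> carrier (poly_ring n :: 'k mpoly ring)" using X Mon_keys by fastforce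
  show ?thesis
    unfolding comp X_def[symmetric]
  proof (rule subset_antisym)
    have id: "ideal (monomial_ideal n X :: 'k mpoly set) (poly_ring n)"
      unfolding monomial_ideal_def by (rule genideal_ideal[OF car])
    have "mon_poly ` X \<subseteq> (monomial_ideal n X :: 'k mpoly set)"
      unfolding monomial_ideal_def by (rule genideal_self[OF car])
    then show "Idl\<^bsub>poly_ring n\<^esub> {p. Poly_Mapping.keys p \<subseteq> X} \<subseteq> (monomial_ideal n X :: 'k mpoly set)"
      using mon_combination_in_ideal[OF id] by (intro genideal_minimal[OF id]) auto
    have "mon_poly ` X \<subseteq> Idl\<^bsub>poly_ring n\<^esub> {p :: 'k mpoly. Poly_Mapping.keys p \<subseteq> X}"
      using genideal_self[OF car'] by auto
    then show "monomial_ideal n X \<subseteq> Idl\<^bsub>poly_ring n\<^esub> {p :: 'k mpoly. Poly_Mapping.keys p \<subseteq> X}"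
      unfolding monomial_ideal_def by (intro genideal_minimal genideal_ideal car')
  qed
qed

lemma irrelevant_ideal_mult:
  assumes L: "L \<subseteq> Mon n d"
  shows "irrelevant_ideal n \<cdot>\<^bsub>poly_ring n\<^esub> monomial_ideal n L = (monomial_ideal n (shadow n L) :: 'k::field mpoly set)"
proof -
  interpret ring "poly_ring n :: 'k mpoly ring" by (rule ring_poly_ring)
  define X where "X = xvar ` {1..n}"
  have Xk: "Poly_Mapping.keys w \<subseteq> {1..n}" if "w \<in> X" for w using that by (auto simp: X_def)
  have Lk: "Poly_Mapping.keys w \<subseteq> {1..n}" if "w \<in> L" for w using that L Mon_keys by blast
  have Sk: "Poly_Mapping.keys w \<subseteq> {1..n}" if "w \<in> shadow n L" for w
  proof -
    from that obtain i l where "w = xvar i + l" "i \<in> {1..n}" "l \<in> L"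
      unfolding shadow_eq_shadow_on by (rule shadow_onE)
    then show ?thesis using Lk by (simp add: keys_mon_add)
  qed
  have irr: "irrelevant_ideal n = (monomial_ideal n X :: 'k mpoly set)"
    unfolding irrelevant_ideal_def monomial_ideal_def X_def var_def image_image xvar_def ..
  have idX: "ideal (monomial_ideal n X :: 'k mpoly set) (poly_ring n)"
    unfolding monomial_ideal_def by (intro genideal_ideal mon_poly_image_carrier Xk)
  have idL: "ideal (monomial_ideal n L :: 'k mpoly set) (poly_ring n)"
    unfolding monomial_ideal_def by (intro genideal_ideal mon_poly_image_carrier Lk)
  note id = ideal_prod_is_ideal[OF idX idL]
  show ?thesis
    unfolding irr
  proof (intro subset_antisym subsetI)
    fix p assume "p \<in> monomial_ideal n X \<cdot>\<^bsub>poly_ring n\<^esub> (monomial_ideal n L :: 'k mpoly set)"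
    then show "p \<in> monomial_ideal n (shadow n L)"
    proof induction
      case (prod f g)
      then have f: "Poly_Mapping.keys f \<subseteq> multiples n X" and g: "Poly_Mapping.keys g \<subseteq> multiples n L"
        using monomial_ideal_eq[OF Xk, where ?'k = 'k] monomial_ideal_eq[OF Lk, where ?'k = 'k] by auto
      have "a + b \<in> multiples n (shadow n L)" if ab: "a \<in> multiples n X" "b \<in> multiples n L" for a b
      proof -
        obtain i z where a: "a = xvar i + z" "i \<in> {1..n}" "Poly_Mapping.keys z \<subseteq> {1..n}"
          using ab(1) unfolding multiples_def X_def by blast
        obtain l y where b: "b = l + y" "l \<in> L" "Poly_Mapping.keys y \<subseteq> {1..n}"
          using ab(2) unfolding multiples_def by blast
        have "a + b = (xvar i + l) + (z + y)" unfolding a b by (simp add: ac_simps)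
        moreover have "xvar i + l \<in> shadow n L" unfolding shadow_eq_shadow_on by (intro shadow_onI a b)
        moreover have "Poly_Mapping.keys (z + y) \<subseteq> {1..n}" using a b by (simp add: keys_mon_add)
        ultimately show ?thesis unfolding multiples_def by blast
      qed
      then have "Poly_Mapping.keys (f * g) \<subseteq> multiples n (shadow n L)"
        using keys_mult[of f g] f g by blast
      then show ?case using monomial_ideal_eq[OF Sk, where ?'k = 'k] by simp
    next
      case (sum f g)
      then show ?case
        using monomial_ideal_eq[OF Sk, where ?'k = 'k] keys_add[of f g] by auto
    qed
  next
    fix p :: "'k mpoly" assume p: "p \<in> monomial_ideal n (shadow n L)"
    have "mon_poly w \<in> monomial_ideal n X \<cdot>\<^bsub>poly_ring n\<^esub> (monomial_ideal n L :: 'k mpoly set)"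
      if "w \<in> shadow n L" for w
    proof -
      from that obtain i l where w: "w = xvar i + l" "i \<in> {1..n}" "l \<in> L"
        unfolding shadow_eq_shadow_on by (rule shadow_onE)
      have "mon_poly (xvar i) \<in> (monomial_ideal n X :: 'k mpoly set)" "mon_poly l \<in> (monomial_ideal n L :: 'k mpoly set)"
        using mon_poly_in_monomial_ideal_iff[of X n, OF Xk, where ?'k = 'k]
          mon_poly_in_monomial_ideal_iff[of L n, OF Lk, where ?'k = 'k]
          subsetD[OF self_multiples[of X n], of "xvar i"] subsetD[OF self_multiples[of L n] w(3)] w(2) by (auto simp: X_def)
      from ideal_prod.prod[OF this, of "poly_ring n"] show ?thesis by (simp add: w mon_poly_add)
    qed
    then have "monomial_ideal n (shadow n L) \<subseteq> monomial_ideal n X \<cdot>\<^bsub>poly_ring n\<^esub> (monomial_ideal n L :: 'k mpoly set)"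
      unfolding monomial_ideal_def[of n "shadow n L"] by (intro genideal_minimal id) auto
    then show "p \<in> monomial_ideal n X \<cdot>\<^bsub>poly_ring n\<^esub> monomial_ideal n L" using p by blast
  qed
qed

text \<open>
  Used to compare an arbitrary generating set \<open>F\<close> of a monomial ideal with the monomial one: the
  components of the elements of \<open>F\<close> in the least degree span that component of the ideal.
\<close>
definition homogeneous_part :: "nat \<Rightarrow> 'k::field mpoly \<Rightarrow> 'k mpoly" where
  "homogeneous_part d p =
    (\<Sum>w\<in>{w \<in> Poly_Mapping.keys p. mon_degree w = d}. Poly_Mapping.single w (Poly_Mapping.lookup p w))"

lemma lookup_homogeneous_part:
  "Poly_Mapping.lookup (homogeneous_part d p) w = (if mon_degree w = d then Poly_Mapping.lookup p w else 0)"
  unfolding homogeneous_part_def lookup_sum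
  by (simp add: lookup_single when_def sum.delta in_keys_iff)

lemma homogeneous_part_add: "homogeneous_part d (p + q) = homogeneous_part d p + homogeneous_part d q"
  by (rule poly_mapping_eqI) (simp add: lookup_homogeneous_part lookup_add)

lemma homogeneous_part_zero [simp]: "homogeneous_part d 0 = 0"
  by (simp add: homogeneous_part_def)

lemma homogeneous_part_mon_poly: "homogeneous_part (mon_degree w) (mon_poly w) = mon_poly w"
  by (rule poly_mapping_eqI) (auto simp: lookup_homogeneous_part mon_poly_def lookup_single when_def)

lemma homogeneous_part_single_mult:
  assumes "\<And>w. w \<in> Poly_Mapping.keys p \<Longrightarrow> d \<le> mon_degree w"
  shows "homogeneous_part d (Poly_Mapping.single z c * p) = (if z = 0 then scale c (homogeneous_part d p) else 0)"
proof (cases "z = 0")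
  case True
  have "Poly_Mapping.lookup (scale c q) w = c * Poly_Mapping.lookup q w" for q :: "'a mpoly" and w
    unfolding scale_def by (simp add: Poly_Mapping.map.rep_eq when_def)
  then show ?thesis
    using True by (intro poly_mapping_eqI) (simp add: lookup_homogeneous_part flip: scale_eq_single_mult)
next
  case False
  then have "mon_degree z \<noteq> 0"
    by (auto simp: mon_degree_def in_keys_iff intro: poly_mapping_eqI)
  then have "mon_degree w \<noteq> d" if "w \<in> Poly_Mapping.keys (Poly_Mapping.single z c * p)" for w
    using that keys_single_mult[of z c p] assms by (fastforce simp: mon_degree_add)
  then show ?thesis
    using False by (intro poly_mapping_eqI) (auto simp: lookup_homogeneous_part in_keys_iff)
qed

text \<open>
  Polynomials whose terms have degree at least \<open>d\<close> and whose component of degree \<open>d\<close> is in the span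
  of the components of \<open>F\<close> form an ideal. If \<open>F\<close> generates the monomial ideal, that span therefore
  contains the linearly independent monomials of \<open>A\<close>.
\<close>
lemma num_generators_monomial_ideal:
  assumes A: "A \<subseteq> Mon n d"
  shows "num_generators n (monomial_ideal n A :: 'k::field mpoly set) = card A"
  unfolding num_generators_def
proof (rule Least_equality)
  interpret ring "poly_ring n :: 'k mpoly ring" by (rule ring_poly_ring)
  have finA: "finite A" using A finite_subset finite_mons unfolding Mon_eq_mons by blast
  have Ak: "Poly_Mapping.keys w \<subseteq> {1..n}" if "w \<in> A" for w using that A Mon_keys by blast
  show "\<exists>F\<subseteq>carrier (poly_ring n). finite F \<and> card F = card A \<and> Idl\<^bsub>poly_ring n\<^esub> F = (monomial_ideal n A :: 'k mpoly set)"
    using finA mon_poly_image_carrier[OF Ak] by (intro exI[of _ "mon_poly ` A"]) (simp add: card_mon_poly_image monomial_ideal_def)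
  fix r assume "\<exists>F\<subseteq>carrier (poly_ring n). finite F \<and> card F = r \<and> Idl\<^bsub>poly_ring n\<^esub> F = (monomial_ideal n A :: 'k mpoly set)"
  then obtain F where F: "F \<subseteq> carrier (poly_ring n)" "finite F" "card F = r"
    "Idl\<^bsub>poly_ring n\<^esub> F = (monomial_ideal n A :: 'k mpoly set)" by blast
  let ?S = "mpoly.span (homogeneous_part d ` F)"
  define W where "W = {p \<in> carrier (poly_ring n :: 'k mpoly ring). (\<forall>w\<in>Poly_Mapping.keys p. d \<le> mon_degree w) \<and> homogeneous_part d p \<in> ?S}"
  have "ideal W (poly_ring n)"
  proof (rule ideal_poly_ringI)
    show "0 \<in> W" by (simp add: W_def mpoly.span_zero)
    show "p + q \<in> W" if "p \<in> W" "q \<in> W" for p q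
      using that keys_add[of p q] by (fastforce simp: W_def homogeneous_part_add intro: mpoly.span_add)
    show "Poly_Mapping.single z c * p \<in> W" if z: "Poly_Mapping.keys z \<subseteq> {1..n}" and p: "p \<in> W" for z c p
    proof -
      have "homogeneous_part d (Poly_Mapping.single z c * p) \<in> ?S"
        using p homogeneous_part_single_mult[of p d z c]
        by (auto simp: W_def intro: mpoly.span_scale mpoly.span_zero)
      then show ?thesis
        using z p keys_single_mult[of z c p] by (fastforce simp: W_def mon_degree_add keys_mon_add)
    qed
  qed (auto simp: W_def)
  moreover have "F \<subseteq> W"
  proof
    fix f assume f: "f \<in> F"
    then have "f \<in> monomial_ideal n A" using genideal_self[OF F(1)] F(4) by blast
    then have "Poly_Mapping.keys f \<subseteq> multiples n A" using monomial_ideal_eq[OF Ak, where ?'k = 'k] by blast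
    then have "\<forall>w\<in>Poly_Mapping.keys f. d \<le> mon_degree w" using multiples_of_degree(1)[OF A] by blast
    moreover have "homogeneous_part d f \<in> ?S" using f by (intro mpoly.span_base) blast
    ultimately show "f \<in> W" using f F(1) unfolding W_def by blast
  qed
  ultimately have sub: "monomial_ideal n A \<subseteq> W" using genideal_minimal F(4) by blast
  have "mon_poly a \<in> ?S" if a: "a \<in> A" for a
  proof -
    have "mon_poly a \<in> (monomial_ideal n A :: 'k mpoly set)"
      using mon_poly_in_monomial_ideal_iff[OF Ak, where ?'k = 'k] self_multiples a by blast
    moreover have "mon_degree a = d" using a A by (auto simp: Mon_def)
    ultimately show ?thesis using sub homogeneous_part_mon_poly[of a, where ?'a = 'k] by (auto simp: W_def)
  qed
  then have "mpoly.span (mon_poly ` A) \<subseteq> ?S" by (intro mpoly.span_minimal) auto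
  then have "mpoly.dim (mpoly.span (mon_poly ` A :: 'k mpoly set)) \<le> card (homogeneous_part d ` F)"
    using F(2) by (intro mpoly.dim_le_card) auto
  also have "\<dots> \<le> r" using card_image_le F by blast
  finally show "card A \<le> r" unfolding dim_span_mon_poly .
qed

text \<open>
  The degree of the generators is the least degree of a term in a nonzero element.
\<close>
lemma generated_in_degree_monomial_ideal:
  assumes L: "L \<subseteq> Mon n d" "L \<noteq> {}"
  shows "generated_in_degree n d' (monomial_ideal n L :: 'k::field mpoly set) \<longleftrightarrow> d' = d"
proof
  interpret ring "poly_ring n :: 'k mpoly ring" by (rule ring_poly_ring)
  have Lk: "Poly_Mapping.keys w \<subseteq> {1..n}" if "w \<in> L" for w using that L Mon_keys by blast
  show "generated_in_degree n d' (monomial_ideal n L :: 'k mpoly set)" if "d' = d"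
    unfolding generated_in_degree_def monomial_ideal_def that
    by (rule exI[of _ "mon_poly ` L"]) (use L in \<open>auto simp: graded_component_def Mon_def\<close>)
  assume "generated_in_degree n d' (monomial_ideal n L :: 'k mpoly set)"
  then obtain F :: "'k mpoly set" where F: "F \<subseteq> graded_component (carrier (poly_ring n)) d'"
    "monomial_ideal n L = Idl\<^bsub>poly_ring n\<^esub> F" unfolding generated_in_degree_def by blast
  obtain l where l: "l \<in> L" using L by blast
  have deg_l: "mon_degree l = d" using l L by (auto simp: Mon_def)
  have lI: "mon_poly l \<in> Idl\<^bsub>poly_ring n\<^esub> F"
    using mon_poly_in_monomial_ideal_iff[OF Lk, where ?'k = 'k] self_multiples l unfolding F(2)[symmetric] by blast
  have "ideal {p \<in> carrier (poly_ring n :: 'k mpoly ring). \<forall>w\<in>Poly_Mapping.keys p. d' \<le> mon_degree w} (poly_ring n)" (is "ideal ?W _")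
  proof (rule ideal_poly_ringI)
    show "p + q \<in> ?W" if "p \<in> ?W" "q \<in> ?W" for p q
      using that keys_add[of p q] by fastforce
    show "Poly_Mapping.single z c * p \<in> ?W" if "Poly_Mapping.keys z \<subseteq> {1..n}" "p \<in> ?W" for z c p
      using that keys_single_mult[of z c p] by (fastforce simp: mon_degree_add keys_mon_add)
  qed auto
  then have "Idl\<^bsub>poly_ring n\<^esub> F \<subseteq> ?W"
    using F(1) by (intro genideal_minimal) (auto simp: graded_component_def)
  then have "mon_poly l \<in> ?W" using lI by blast
  then have "d' \<le> d" using deg_l by simp
  have "\<not> F \<subseteq> {0}"
  proof
    assume "F \<subseteq> {0}"
    then have "Idl\<^bsub>poly_ring n\<^esub> F \<subseteq> {0}"
      by (intro genideal_minimal ideal_poly_ringI) auto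
    then have "mon_poly l = (0 :: 'k mpoly)" using lI by blast
    then show False by (metis keys_mon_poly keys_zero insert_not_empty)
  qed
  then obtain f where f: "f \<in> F" "f \<noteq> 0" by blast
  then obtain w where w: "w \<in> Poly_Mapping.keys f" by (metis all_not_in_conv keys_eq_empty)
  have "mon_degree w = d'" using w f F(1) by (auto simp: graded_component_def)
  moreover have "F \<subseteq> Idl\<^bsub>poly_ring n\<^esub> F" using F(1) by (intro genideal_self) (auto simp: graded_component_def)
  then have "w \<in> multiples n L"
    using f w monomial_ideal_eq[OF Lk, where ?'k = 'k] F(2) by blast
  then have "d \<le> mon_degree w" using multiples_of_degree(1)[OF L(1)] by blast
  ultimately show "d' = d" using \<open>d' \<le> d\<close> by simp
qed

text \<open>
  The generators of the maximal ideal times a monomial ideal generated in one degree are counted by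
  the shadow, for the given ideal as well as for its lexicographic counterpart.
\<close>
theorem gotzmann_monomial_ideal_iff:
  assumes L: "L \<subseteq> Mon n d" "L \<noteq> {}"
  shows "gotzmann n (monomial_ideal n L :: 'k::field mpoly set) \<longleftrightarrow>
    card (shadow n L) = card (shadow n (initial_lexseg n d (card L)))"
proof -
  have sh: "shadow n A \<subseteq> Mon n (Suc d)" if "A \<subseteq> Mon n d" for A
    using that shadow_on_mons unfolding shadow_eq_shadow_on Mon_eq_mons by blast
  have gens: "num_generators n (irrelevant_ideal n \<cdot>\<^bsub>poly_ring n\<^esub> monomial_ideal n A :: 'k mpoly set) = card (shadow n A)"
    if "A \<subseteq> Mon n d" for A
    unfolding irrelevant_ideal_mult[OF that] by (rule num_generators_monomial_ideal[OF sh[OF that]])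
  have "initial_lexseg n d (card L) \<subseteq> Mon n d" by (auto simp: initial_lexseg_def)
  then show ?thesis
    unfolding gotzmann_def generated_in_degree_monomial_ideal[OF L]
    by (simp add: gens L component_ideal_lex_ideal hilbert_function_monomial_ideal)
qed

lemma mon_poly_mult_ideal_of_variables:
  assumes K: "K \<subseteq> {1..n}" and m: "Poly_Mapping.keys m \<subseteq> {1..n}"
  shows "(*) (mon_poly m) ` (Idl\<^bsub>poly_ring n\<^esub> (var ` K)) =
    (monomial_ideal n ((\<lambda>i. xvar i + m) ` K) :: 'k::field mpoly set)"
proof -
  interpret ring "poly_ring n :: 'k mpoly ring" by (rule ring_poly_ring)
  define J where "J = Idl\<^bsub>poly_ring n\<^esub> (var ` K :: 'k mpoly set)"
  have car: "var ` K \<subseteq> carrier (poly_ring n :: 'k mpoly ring)" using K by (auto simp: var_def)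
  have idJ: "ideal J (poly_ring n)" unfolding J_def by (rule genideal_ideal[OF car])
  then interpret J: ideal J "poly_ring n" .
  have Jcar: "J \<subseteq> carrier (poly_ring n)" using J.a_subset by simp
  let ?S = "(\<lambda>i. xvar i + m) ` K"
  have Sk: "Poly_Mapping.keys w \<subseteq> {1..n}" if "w \<in> ?S" for w
  proof -
    obtain i where "i \<in> K" "w = xvar i + m" using \<open>w \<in> ?S\<close> by blast
    then show ?thesis using K m by (simp add: keys_mon_add subset_iff)
  qed
  have gen: "mon_poly (xvar i + m) = (mon_poly m * var i :: 'k mpoly)" for i
    by (simp add: var_def mon_poly_add xvar_def mult.commute)
  show ?thesis
    unfolding J_def[symmetric]
  proof (rule subset_antisym)
    have "ideal ((*) (mon_poly m) ` J) (poly_ring n)"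
    proof (rule ideal_poly_ringI)
      have mc: "mon_poly m \<in> carrier (poly_ring n :: 'k mpoly ring)" using m by simp
      show "(*) (mon_poly m) ` J \<subseteq> carrier (poly_ring n)"
      proof (rule image_subsetI)
        fix q assume "q \<in> J"
        then show "mon_poly m * q \<in> carrier (poly_ring n)"
          using m_closed[OF mc, of q] Jcar unfolding poly_ring_simps(2) by blast
      qed
      have "0 \<in> J" using J.zero_closed by simp
      then show "0 \<in> (*) (mon_poly m) ` J" by (rule rev_image_eqI) simp
      show "p + q \<in> (*) (mon_poly m) ` J" if pq: "p \<in> (*) (mon_poly m) ` J" "q \<in> (*) (mon_poly m) ` J" for p q
      proof -
        obtain p' q' where p': "p = mon_poly m * p'" "p' \<in> J" and q': "q = mon_poly m * q'" "q' \<in> J"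
          using pq by blast
        have "p' + q' \<in> J" using additive_subgroup.a_closed[OF ideal.axioms(1)[OF idJ] p'(2) q'(2)] by simp
        then show ?thesis unfolding p' q' distrib_left[symmetric] by blast
      qed
      show "Poly_Mapping.single z c * p \<in> (*) (mon_poly m) ` J"
        if z: "Poly_Mapping.keys z \<subseteq> {1..n}" and p: "p \<in> (*) (mon_poly m) ` J" for z c p
      proof -
        obtain q where q: "p = mon_poly m * q" "q \<in> J" using p by blast
        have "Poly_Mapping.single z c \<in> carrier (poly_ring n)" using z by simp
        then have "Poly_Mapping.single z c * q \<in> J" using J.I_l_closed[OF q(2)] by simp
        moreover have "Poly_Mapping.single z c * p = mon_poly m * (Poly_Mapping.single z c * q)"
          unfolding q by (rule mult.left_commute)
        ultimately show ?thesis by blast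
      qed
    qed
    moreover have "mon_poly ` ?S \<subseteq> (*) (mon_poly m) ` J"
      using genideal_self[OF car] unfolding J_def[symmetric] by (auto simp: gen intro!: imageI)
    ultimately show "monomial_ideal n ?S \<subseteq> (*) (mon_poly m) ` J"
      unfolding monomial_ideal_def by (rule genideal_minimal)
    have J_eq: "J = monomial_ideal n (xvar ` K)"
      unfolding J_def monomial_ideal_def var_def image_image xvar_def ..
    have Kk: "Poly_Mapping.keys w \<subseteq> {1..n}" if "w \<in> xvar ` K" for w using that K by auto
    show "(*) (mon_poly m) ` J \<subseteq> monomial_ideal n ?S"
    proof (rule image_subsetI)
      fix q assume "q \<in> J"
      then have q: "Poly_Mapping.keys q \<subseteq> multiples n (xvar ` K)"
        using monomial_ideal_eq[of "xvar ` K" n, OF Kk, where ?'k = 'k] unfolding J_eq by blast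
      have "m + w \<in> multiples n ?S" if wX: "w \<in> multiples n (xvar ` K)" for w
      proof -
        obtain i z where w: "w = xvar i + z" "i \<in> K" "Poly_Mapping.keys z \<subseteq> {1..n}"
          using wX unfolding multiples_def by blast
        have "m + w = (xvar i + m) + z" unfolding w by (simp add: ac_simps)
        then show ?thesis using w(2,3) unfolding multiples_def by blast
      qed
      then have "Poly_Mapping.keys (mon_poly m * q) \<subseteq> multiples n ?S"
        using q keys_single_mult[of m 1 q] unfolding mon_poly_def by blast
      then show "mon_poly m * q \<in> monomial_ideal n ?S"
        using monomial_ideal_eq[of ?S n, OF Sk, where ?'k = 'k] by blast
    qed
  qed
qed

section \<open>The characterization\<close>

theorem theorem9:
  fixes n d t :: nat and u v :: "nat \<Rightarrow>\<^sub>0 nat" and I :: "'k::field mpoly set"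
  assumes "u \<in> Mon n d" and "v \<in> Mon n d"
    and "Poly_Mapping.keys u \<subseteq> {t..n}" and "Poly_Mapping.keys v \<subseteq> {t..n}"
    and "v < u"
    and "Poly_Mapping.lookup u t \<noteq> 0" and "t \<ge> 1"
    and "I = monomial_ideal n (lexseg n d u v)"
    and "\<not> completely_lexsegment_ideal n I"
  shows "gotzmann n I \<longleftrightarrow>
    (\<exists>l p m. t \<le> l \<and> l \<le> n \<and> 1 \<le> p \<and> p \<le> n - l \<and> Poly_Mapping.keys m \<subseteq> {1..n} \<and>
       I = (*) (mon_poly m) ` (Idl\<^bsub>poly_ring n\<^esub> (var ` {l..l + p})))"
proof -
  define L where "L = lexseg n d u v"
  have L: "L \<subseteq> Mon n d" "u \<in> L" using assms(1,5) by (auto simp: L_def lexseg_def)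
  then have "L \<noteq> {}" by blast
  have I: "I = monomial_ideal n L" by (simp add: L_def assms(8))
  note gotz = gotzmann_monomial_ideal_iff[OF L(1) \<open>L \<noteq> {}\<close>, where ?'k = 'k, folded I]
  show ?thesis
  proof
    assume "gotzmann n I"
    then have "card (shadow n L) \<le> card (shadow n (initial_lexseg n d (card L)))" using gotz by simp
    moreover have "\<not> completely_lexsegment_set n d L"
      using assms(9) I unfolding completely_lexsegment_ideal_def by blast
    ultimately obtain m where "\<forall>w\<in>L. \<exists>i. w = xvar i + m"
      using lexseg_minimal_growth_imp_star[OF assms(1,2,5)] unfolding L_def by blast
    then obtain l p where lp: "t \<le> l" "1 \<le> p" "l + p \<le> n" "L = (\<lambda>i. xvar i + m) ` {l..l + p}"
      using lexseg_star_consecutive[OF assms(1,2,5,3,4,7)] unfolding L_def by blast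
    have "xvar l + m \<in> Mon n d" using L(1) lp(4) by auto
    then have m: "Poly_Mapping.keys m \<subseteq> {1..n}" using Mon_keys by (metis keys_mon_add le_sup_iff)
    have "I = (*) (mon_poly m) ` (Idl\<^bsub>poly_ring n\<^esub> (var ` {l..l + p}))"
      unfolding I lp(4) using lp assms(7) m by (intro mon_poly_mult_ideal_of_variables[symmetric]) auto
    then show "\<exists>l p m. t \<le> l \<and> l \<le> n \<and> 1 \<le> p \<and> p \<le> n - l \<and> Poly_Mapping.keys m \<subseteq> {1..n} \<and>
       I = (*) (mon_poly m) ` (Idl\<^bsub>poly_ring n\<^esub> (var ` {l..l + p}))"
      using lp m by (intro exI[of _ l] exI[of _ p] exI[of _ m]) auto
  next
    assume "\<exists>l p m. t \<le> l \<and> l \<le> n \<and> 1 \<le> p \<and> p \<le> n - l \<and> Poly_Mapping.keys m \<subseteq> {1..n} \<and>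
       I = (*) (mon_poly m) ` (Idl\<^bsub>poly_ring n\<^esub> (var ` {l..l + p}))"
    then obtain l p m where lp: "t \<le> l" "l \<le> n" "p \<le> n - l" and m: "Poly_Mapping.keys m \<subseteq> {1..n}"
      and eq: "I = (*) (mon_poly m) ` (Idl\<^bsub>poly_ring n\<^esub> (var ` {l..l + p}))" by blast
    define K where "K = {l..l + p}"
    define M where "M = (\<lambda>i. xvar i + m) ` K"
    have K: "K \<subseteq> {1..n}" using lp assms(7) by (auto simp: K_def)
    have "M \<subseteq> Mon n (Suc (mon_degree m))"
      using K m by (auto simp: M_def Mon_def mon_degree_add keys_mon_add simp del: atLeastAtMost_iff)
    moreover have "monomial_ideal n L = (monomial_ideal n M :: 'k mpoly set)"
      using mon_poly_mult_ideal_of_variables[OF K m, where ?'k = 'k] eq I unfolding M_def K_def by simp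
    ultimately have LM: "L = M" using monomial_ideal_inject[OF L(1)] by blast
    then have "mon_degree u = Suc (mon_degree m)" using L(2) by (auto simp: M_def mon_degree_add)
    then have d: "1 \<le> d" using assms(1) by (simp add: Mon_def)
    have finV: "finite {1..n}" by simp
    have fin: "finite L" using L(1) finite_mons[OF finV] finite_subset unfolding Mon_eq_mons by blast
    have cardL: "card L = card K" unfolding LM M_def by (rule card_star)
    have leV: "card L \<le> card {1..n}" unfolding cardL using K by (intro card_mono) auto
    have "card (shadow_on {1..n} L) = star_growth n (card L)"
      using card_shadow_on_star_le[OF finV K, of m] star_growth_le_card_shadow_on[OF finV fin] cardL
      unfolding LM M_def by simp
    moreover have "card (shadow_on {1..n} (initial_lexseg n d (card L))) = star_growth n (card L)"
    proof -
      define D where "D = top_set (mons {1..n} d) (card L)"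
      have "upset_in (mons {1..n} d) D" "card D = card L"
        unfolding D_def using finite_mons[OF finV] L(1)[unfolded Mon_eq_mons]
        by (simp_all add: upset_in_top_set card_top_set card_mono)
      moreover have "initial_lexseg n d (card L) = D"
        by (simp add: initial_lexseg_def top_set_def D_def Mon_eq_mons)
      ultimately show ?thesis using card_shadow_on_initial_small[OF finV d, of D] leV by simp
    qed
    ultimately show "gotzmann n I" using gotz by (simp add: shadow_eq_shadow_on)
  qed
qed

end
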